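(* Let $v_k\in V$, let $\tilde v_{k+1}:=q(v_k)$, and let $w_{k+1}:=\tilde v_{k+1}-v_k$ be the Picard residual. Then $$\|\nabla w_{k+1}\|\le\nu^{-1}\|g(v_k)\|_{V'}$$ and $$\|g(\tilde v_{k+1})\|_{V'}\le\kappa\|g(v_k)\|_{V'}.$$
   Context: Let $\Omega\subset\mathbb{R}^d$ ($d=2$ or $3$) be a bounded open connected set, $\nu>0$, and $f\in H^{-1}(\Omega)$ (vector valued). $\|\cdot\|$ and $(\cdot,\cdot)$ denote the $L^2(\Omega)$ norm and inner product; $(\cdot,\cdot)$ also denotes dual pairings. Let $X=H^1_0(\Omega)^d$ and $Q=\{q\in L^2(\Omega):\int_\Omega q\,dx=0\}$, and let $V=\{v\in X:(\nabla\cdot v,q)=0\ \forall q\in Q\}$ be the divergence-free subspace, with dual $V'$. Dual norms are taken with respect to $\|\nabla\cdot\|$: $\|F\|_{V'}=\sup_{0\ne\chi\in V}(F,\chi)/\|\nabla\chi\|$ and $\|f\|_{-1}=\|f\|_{H^{-1}}=\sup_{0\ne\chi\in X}(f,\chi)/\|\nabla\chi\|$. $M$ is a constant, depending only on the size of $\Omega$, such that for all $v,w,\chi\in X$: $(v\cdot\nabla w,\chi)\le M\|\nabla v\|\|\nabla w\|\|\nabla\chi\|$ and $\|v\cdot\nabla w\|_{V'}\le M\|\nabla v\|\|\nabla w\|$. Set $\kappa:=M\nu^{-2}\|f\|_{-1}$. The Picard solution operator $q:V\to V$ for the steady Navier-Stokes equations is defined by: for $v\in V$, $q(v)\in V$ is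 the unique solution of $\nu(\nabla q(v),\nabla\chi)+(v\cdot\nabla q(v),\chi)=(f,\chi)$ for all $\chi\in V$. The nonlinear residual $g:V\to V'$ is defined by $(g(v),\chi)=\nu(\nabla v,\nabla\chi)+(v\cdot\nabla v,\chi)-(f,\chi)$ for all $\chi\in V$. *)

theory Defs
  imports "HOL-Analysis.Analysis"
begin

text \<open>
  Elements of Lebesgue and Sobolev spaces over \<open>\<Omega>\<close> are represented by functions on the whole
  space; only their values on \<open>\<Omega>\<close>, up to null sets, matter.
\<close>

definition L2 :: "(real^'d) set \<Rightarrow> (real^'d \<Rightarrow> 'b::euclidean_space) set" where
  "L2 \<Omega> = {u. u \<in> borel_measurable (lebesgue_on \<Omega>) \<and>
              integrable (lebesgue_on \<Omega>) (\<lambda>x. (norm (u x))\<^sup>2)}"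

definition L2_inner ::
    "(real^'d) set \<Rightarrow> (real^'d \<Rightarrow> 'b::euclidean_space) \<Rightarrow> (real^'d \<Rightarrow> 'b) \<Rightarrow> real" where
  "L2_inner \<Omega> u v = integral\<^sup>L (lebesgue_on \<Omega>) (\<lambda>x. u x \<bullet> v x)"

definition L2_norm :: "(real^'d) set \<Rightarrow> (real^'d \<Rightarrow> 'b::euclidean_space) \<Rightarrow> real" where
  "L2_norm \<Omega> u = sqrt (L2_inner \<Omega> u u)"

definition ae_eq :: "(real^'d) set \<Rightarrow> (real^'d \<Rightarrow> 'b::euclidean_space) \<Rightarrow> (real^'d \<Rightarrow> 'b) \<Rightarrow> bool" where
  "ae_eq \<Omega> u v \<longleftrightarrow> (AE x in lebesgue_on \<Omega>. u x = v x)"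

subsection \<open>Test functions and \<open>H\<^sup>1\<^sub>0\<close>\<close>

definition classical_grad :: "(real^'d \<Rightarrow> real) \<Rightarrow> real^'d \<Rightarrow> real^'d" where
  "classical_grad \<phi> x = (\<chi> j. frechet_derivative \<phi> (at x) (axis j 1))"

primrec C_k :: "nat \<Rightarrow> (real^'d \<Rightarrow> real) \<Rightarrow> bool" where
  "C_k 0 \<phi> \<longleftrightarrow> continuous_on UNIV \<phi>"
| "C_k (Suc k) \<phi> \<longleftrightarrow> (\<forall>x. \<phi> differentiable at x) \<and> (\<forall>j. C_k k (\<lambda>x. classical_grad \<phi> x $ j))"

definition test_functions :: "(real^'d) set \<Rightarrow> (real^'d \<Rightarrow> real) set" where
  "test_functions \<Omega> = {\<phi>. (\<forall>k. C_k k \<phi>) \<and>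
     compact (closure {x. \<phi> x \<noteq> 0}) \<and> closure {x. \<phi> x \<noteq> 0} \<subseteq> \<Omega>}"

definition has_weak_grad :: "(real^'d) set \<Rightarrow> (real^'d \<Rightarrow> real) \<Rightarrow> (real^'d \<Rightarrow> real^'d) \<Rightarrow> bool" where
  "has_weak_grad \<Omega> u G \<longleftrightarrow> G \<in> L2 \<Omega> \<and>
     (\<forall>\<phi>\<in>test_functions \<Omega>. \<forall>j.
        L2_inner \<Omega> u (\<lambda>x. classical_grad \<phi> x $ j) = - L2_inner \<Omega> (\<lambda>x. G x $ j) \<phi>)"

definition H1 :: "(real^'d) set \<Rightarrow> (real^'d \<Rightarrow> real) set" where
  "H1 \<Omega> = {u \<in> L2 \<Omega>. \<exists>G. has_weak_grad \<Omega> u G}"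

text \<open>A representative of the weak gradient, which is determined up to null sets.\<close>

definition weak_grad :: "(real^'d) set \<Rightarrow> (real^'d \<Rightarrow> real) \<Rightarrow> real^'d \<Rightarrow> real^'d" where
  "weak_grad \<Omega> u = (SOME G. has_weak_grad \<Omega> u G)"

text \<open>The closure of the test functions in the \<open>H\<^sup>1\<close> norm.\<close>

definition H10 :: "(real^'d) set \<Rightarrow> (real^'d \<Rightarrow> real) set" where
  "H10 \<Omega> = {u \<in> H1 \<Omega>. \<forall>\<epsilon>>0. \<exists>\<phi>\<in>test_functions \<Omega>.
     (L2_norm \<Omega> (\<lambda>x. u x - \<phi> x))\<^sup>2
       + (L2_norm \<Omega> (\<lambda>x. weak_grad \<Omega> u x - classical_grad \<phi> x))\<^sup>2 < \<epsilon>\<^sup>2}"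

subsection \<open>Velocity and pressure spaces\<close>

definition X_space :: "(real^'d) set \<Rightarrow> (real^'d \<Rightarrow> real^'d) set" where
  "X_space \<Omega> = {v. \<forall>i. (\<lambda>x. v x $ i) \<in> H10 \<Omega>}"

text \<open>Row \<open>i\<close> of the Jacobian is the gradient of the component \<open>v\<^sub>i\<close>; the inner product of
  \<open>real^'d^'d\<close> is the Frobenius one.\<close>

definition grad :: "(real^'d) set \<Rightarrow> (real^'d \<Rightarrow> real^'d) \<Rightarrow> real^'d \<Rightarrow> real^'d^'d" where
  "grad \<Omega> v x = (\<chi> i. weak_grad \<Omega> (\<lambda>y. v y $ i) x)"

definition divergence :: "(real^'d) set \<Rightarrow> (real^'d \<Rightarrow> real^'d) \<Rightarrow> real^'d \<Rightarrow> real" where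
  "divergence \<Omega> v x = (\<Sum>i\<in>UNIV. grad \<Omega> v x $ i $ i)"

definition Q_space :: "(real^'d) set \<Rightarrow> (real^'d \<Rightarrow> real) set" where
  "Q_space \<Omega> = {p \<in> L2 \<Omega>. integral\<^sup>L (lebesgue_on \<Omega>) p = 0}"

definition V_space :: "(real^'d) set \<Rightarrow> (real^'d \<Rightarrow> real^'d) set" where
  "V_space \<Omega> = {v \<in> X_space \<Omega>. \<forall>p\<in>Q_space \<Omega>. L2_inner \<Omega> (divergence \<Omega> v) p = 0}"

abbreviation grad_norm :: "(real^'d) set \<Rightarrow> (real^'d \<Rightarrow> real^'d) \<Rightarrow> real" where
  "grad_norm \<Omega> v \<equiv> L2_norm \<Omega> (grad \<Omega> v)"

subsection \<open>Functionals and dual norms\<close>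

definition dual_norm ::
    "(real^'d) set \<Rightarrow> (real^'d \<Rightarrow> real^'d) set \<Rightarrow> ((real^'d \<Rightarrow> real^'d) \<Rightarrow> real) \<Rightarrow> real" where
  "dual_norm \<Omega> W F = Sup {F \<psi> / grad_norm \<Omega> \<psi> |\<psi>. \<psi> \<in> W \<and> \<not> ae_eq \<Omega> \<psi> (\<lambda>x. 0)}"

text \<open>Bounded linear functionals on \<open>X\<close>. Boundedness with respect to the gradient norm also makes
  them independent of the choice of representatives.\<close>

definition H_minus1 :: "(real^'d) set \<Rightarrow> ((real^'d \<Rightarrow> real^'d) \<Rightarrow> real) set" where
  "H_minus1 \<Omega> = {f.
     (\<forall>u\<in>X_space \<Omega>. \<forall>v\<in>X_space \<Omega>. \<forall>a b.
        f (\<lambda>x. a *\<^sub>R u x + b *\<^sub>R v x) = a * f u + b * f v) \<and>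
     (\<exists>C. \<forall>\<psi>\<in>X_space \<Omega>. \<bar>f \<psi>\<bar> \<le> C * grad_norm \<Omega> \<psi>)}"

subsection \<open>The convective term\<close>

definition convect ::
    "(real^'d) set \<Rightarrow> (real^'d \<Rightarrow> real^'d) \<Rightarrow> (real^'d \<Rightarrow> real^'d) \<Rightarrow> real^'d \<Rightarrow> real^'d" where
  "convect \<Omega> v w x = grad \<Omega> w x *v v x"

text \<open>The Lebesgue integral of a non-integrable function is 0 by convention, so the existence of the
  integral, implicit in an inequality for \<open>(v \<cdot> \<nabla>w, \<psi>)\<close>, is spelled out. In dimensions 2 and 3 it
  always holds, by the Sobolev embedding into \<open>L\<^sup>4\<close>.\<close>

definition convection_constant :: "(real^'d) set \<Rightarrow> real \<Rightarrow> bool" where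
  "convection_constant \<Omega> M \<longleftrightarrow>
     (\<forall>v\<in>X_space \<Omega>. \<forall>w\<in>X_space \<Omega>. \<forall>\<psi>\<in>X_space \<Omega>.
        integrable (lebesgue_on \<Omega>) (\<lambda>x. convect \<Omega> v w x \<bullet> \<psi> x) \<and>
        L2_inner \<Omega> (convect \<Omega> v w) \<psi> \<le> M * grad_norm \<Omega> v * grad_norm \<Omega> w * grad_norm \<Omega> \<psi>) \<and>
     (\<forall>v\<in>X_space \<Omega>. \<forall>w\<in>X_space \<Omega>.
        dual_norm \<Omega> (V_space \<Omega>) (L2_inner \<Omega> (convect \<Omega> v w)) \<le> M * grad_norm \<Omega> v * grad_norm \<Omega> w)"

subsection \<open>Picard operator and nonlinear residual\<close>

definition picard_solution ::
    "(real^'d) set \<Rightarrow> real \<Rightarrow> ((real^'d \<Rightarrow> real^'d) \<Rightarrow> real) \<Rightarrow>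
     (real^'d \<Rightarrow> real^'d) \<Rightarrow> (real^'d \<Rightarrow> real^'d) \<Rightarrow> bool" where
  "picard_solution \<Omega> \<nu> f v u \<longleftrightarrow> u \<in> V_space \<Omega> \<and>
     (\<forall>\<psi>\<in>V_space \<Omega>.
        \<nu> * L2_inner \<Omega> (grad \<Omega> u) (grad \<Omega> \<psi>) + L2_inner \<Omega> (convect \<Omega> v u) \<psi> = f \<psi>)"

definition picard_operator ::
    "(real^'d) set \<Rightarrow> real \<Rightarrow> ((real^'d \<Rightarrow> real^'d) \<Rightarrow> real) \<Rightarrow>
     ((real^'d \<Rightarrow> real^'d) \<Rightarrow> (real^'d \<Rightarrow> real^'d)) \<Rightarrow> bool" where
  "picard_operator \<Omega> \<nu> f q \<longleftrightarrow>
     (\<forall>v\<in>V_space \<Omega>. picard_solution \<Omega> \<nu> f v (q v) \<and>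
        (\<forall>u. picard_solution \<Omega> \<nu> f v u \<longrightarrow> ae_eq \<Omega> u (q v)))"

definition nonlinear_residual ::
    "(real^'d) set \<Rightarrow> real \<Rightarrow> ((real^'d \<Rightarrow> real^'d) \<Rightarrow> real) \<Rightarrow>
     (real^'d \<Rightarrow> real^'d) \<Rightarrow> (real^'d \<Rightarrow> real^'d) \<Rightarrow> real" where
  "nonlinear_residual \<Omega> \<nu> f v \<psi> =
     \<nu> * L2_inner \<Omega> (grad \<Omega> v) (grad \<Omega> \<psi>) + L2_inner \<Omega> (convect \<Omega> v v) \<psi> - f \<psi>"

end

theory Submission
  imports Defs
begin

text \<open>
  Write \<open>b(u, w, \<psi>) = (u \<cdot> \<nabla>w, \<psi>)\<close> and \<open>v' = q v\<close>, \<open>w = v' - v\<close>. Subtracting the Picard equation for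
  \<open>v'\<close> from the definition of \<open>g(v)\<close> and \<open>g(v')\<close> gives, for every test field \<open>\<psi>\<close> in \<open>V\<close>,
  \<open>g(v)(\<psi>) = - \<nu> (\<nabla>w, \<nabla>\<psi>) - b(v, w, \<psi>)\<close> and \<open>g(v')(\<psi>) = b(w, v', \<psi>)\<close>.
  Everything rests on the identity \<open>b(v, u, u) = 0\<close> for \<open>v\<close> in \<open>V\<close> and \<open>u\<close> in \<open>X\<close>
  (lemma \<open>convection_skew\<close>). Testing the first equation with \<open>w\<close> turns it into
  \<open>\<nu> \<parallel>\<nabla>w\<parallel>\<^sup>2 = - g(v)(w)\<close>, which is the first estimate. Testing the Picard equation with \<open>v'\<close> gives
  \<open>\<nu> \<parallel>\<nabla>v'\<parallel>\<^sup>2 = f(v')\<close>, hence \<open>\<parallel>\<nabla>v'\<parallel> \<le> \<nu>\<inverse> \<parallel>f\<parallel>\<close> in the dual norm, and the second estimate is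
  \<open>\<parallel>g(v')\<parallel> \<le> M \<parallel>\<nabla>w\<parallel> \<parallel>\<nabla>v'\<parallel>\<close> combined with these two bounds.

  Three facts about the function spaces stand behind this short computation.

  \<^item> The gradient of a field in \<open>X\<close> is a chosen weak gradient. It is linear up to null sets because weak
    gradients are unique, which is the fundamental lemma of the calculus of variations
    (\<open>L2_orthogonal_test_functions_imp_AE_0\<close>): smooth bumps approximate indicators of boxes, and the
    boxes generate the Borel sets.

  \<^item> The identity \<open>b(v, u, u) = 0\<close> is an integration by parts when the components of \<open>u\<close> are test
    functions, and extends to \<open>X\<close> by density and by the bound on \<open>b\<close> that defines \<open>M\<close>. Integration by
    parts reduces to \<open>\<integral> \<partial>\<^sub>j \<phi> = 0\<close>, that is, to the translation invariance of Lebesgue measure.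

  \<^item> The dual norms are suprema of real sets, so they carry information only if these sets are nonempty
    and bounded above. Nonemptiness asks for a nonzero divergence-free field; a compactly supported
    rotation about a point is one (\<open>V_space_nontrivial\<close>).
\<close>

section \<open>Square-integrable functions\<close>

lemma L2_measurable: "u \<in> L2 \<Omega> \<Longrightarrow> u \<in> borel_measurable (lebesgue_on \<Omega>)"
  by (simp add: L2_def)

lemma L2_inner_integrable:
  assumes "u \<in> L2 \<Omega>" "v \<in> L2 \<Omega>"
  shows "integrable (lebesgue_on \<Omega>) (\<lambda>x. u x \<bullet> v x)"
proof (rule Bochner_Integration.integrable_bound)
  show "integrable (lebesgue_on \<Omega>) (\<lambda>x. (norm (u x))\<^sup>2 + (norm (v x))\<^sup>2)"
    using assms by (auto simp: L2_def)
  show "(\<lambda>x. u x \<bullet> v x) \<in> borel_measurable (lebesgue_on \<Omega>)"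
    using assms by (auto simp: L2_def)
  have "\<bar>u x \<bullet> v x\<bar> \<le> (norm (u x))\<^sup>2 + (norm (v x))\<^sup>2" for x
    using Cauchy_Schwarz_ineq2[of "u x" "v x"] sum_squares_bound[of "norm (u x)" "norm (v x)"]
      mult_nonneg_nonneg[OF norm_ge_zero[of "u x"] norm_ge_zero[of "v x"]]
    by linarith
  then show "AE x in lebesgue_on \<Omega>. norm (u x \<bullet> v x) \<le> norm ((norm (u x))\<^sup>2 + (norm (v x))\<^sup>2)"
    by auto
qed

lemma L2_lincomb:
  assumes "u \<in> L2 \<Omega>" "v \<in> L2 \<Omega>"
  shows "(\<lambda>x. a *\<^sub>R u x + b *\<^sub>R v x) \<in> L2 \<Omega>"
proof -
  have eq: "(\<lambda>x. (norm (a *\<^sub>R u x + b *\<^sub>R v x))\<^sup>2)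
      = (\<lambda>x. (a * a) * (u x \<bullet> u x) + (2 * a * b) * (u x \<bullet> v x) + (b * b) * (v x \<bullet> v x))"
  proof
    fix x
    show "(norm (a *\<^sub>R u x + b *\<^sub>R v x))\<^sup>2
      = (a * a) * (u x \<bullet> u x) + (2 * a * b) * (u x \<bullet> v x) + (b * b) * (v x \<bullet> v x)"
      unfolding power2_norm_eq_inner inner_add_left inner_add_right inner_scaleR_left
        inner_scaleR_right inner_commute[of "v x" "u x"]
      by (simp add: algebra_simps del: dot_square_norm)
  qed
  have "integrable (lebesgue_on \<Omega>) (\<lambda>x. (norm (a *\<^sub>R u x + b *\<^sub>R v x))\<^sup>2)"
    unfolding eq
    by (intro Bochner_Integration.integrable_add integrable_mult_right L2_inner_integrable assms)
  moreover have "(\<lambda>x. a *\<^sub>R u x + b *\<^sub>R v x) \<in> borel_measurable (lebesgue_on \<Omega>)"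
    by (intro borel_measurable_add borel_measurable_scaleR borel_measurable_const
        L2_measurable assms)
  ultimately show ?thesis by (simp add: L2_def)
qed

lemma L2_diff: "u \<in> L2 \<Omega> \<Longrightarrow> v \<in> L2 \<Omega> \<Longrightarrow> (\<lambda>x. u x - v x) \<in> L2 \<Omega>"
  using L2_lincomb[of u \<Omega> v 1 "-1"] by simp

lemma L2_inner_commute: "L2_inner \<Omega> u v = L2_inner \<Omega> v u"
  by (simp add: L2_inner_def inner_commute)

lemma L2_inner_lincomb_left:
  assumes "u \<in> L2 \<Omega>" "v \<in> L2 \<Omega>" "w \<in> L2 \<Omega>"
  shows "L2_inner \<Omega> (\<lambda>x. a *\<^sub>R u x + b *\<^sub>R v x) w = a * L2_inner \<Omega> u w + b * L2_inner \<Omega> v w"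
  using L2_inner_integrable[OF assms(1,3)] L2_inner_integrable[OF assms(2,3)]
  by (simp add: L2_inner_def inner_simps)

lemma L2_inner_diff_left:
  assumes "u \<in> L2 \<Omega>" "v \<in> L2 \<Omega>" "w \<in> L2 \<Omega>"
  shows "L2_inner \<Omega> (\<lambda>x. u x - v x) w = L2_inner \<Omega> u w - L2_inner \<Omega> v w"
  using L2_inner_lincomb_left[OF assms, of 1 "-1"] by simp

lemma L2_inner_self_nonneg: "0 \<le> L2_inner \<Omega> u u"
  by (simp add: L2_inner_def)

lemma L2_norm_nonneg: "0 \<le> L2_norm \<Omega> u"
  by (simp add: L2_norm_def L2_inner_self_nonneg)

lemma L2_norm_power2: "(L2_norm \<Omega> u)\<^sup>2 = L2_inner \<Omega> u u"
  by (simp add: L2_norm_def L2_inner_self_nonneg)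

text \<open>
  The inner product only sees classes of functions modulo null sets; this is how identities between
  weak gradients, which hold almost everywhere, enter inner products and norms.
\<close>

lemma L2_inner_cong:
  assumes "u \<in> borel_measurable (lebesgue_on \<Omega>)" "u' \<in> borel_measurable (lebesgue_on \<Omega>)"
    and "v \<in> borel_measurable (lebesgue_on \<Omega>)" "v' \<in> borel_measurable (lebesgue_on \<Omega>)"
    and "ae_eq \<Omega> u u'" "ae_eq \<Omega> v v'"
  shows "L2_inner \<Omega> u v = L2_inner \<Omega> u' v'"
  unfolding L2_inner_def using assms unfolding ae_eq_def
  by (intro integral_cong_AE) (auto)

lemma L2_norm_cong:
  assumes "u \<in> borel_measurable (lebesgue_on \<Omega>)" "u' \<in> borel_measurable (lebesgue_on \<Omega>)"
    and "ae_eq \<Omega> u u'"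
  shows "L2_norm \<Omega> u = L2_norm \<Omega> u'"
  unfolding L2_norm_def using L2_inner_cong[OF assms(1,2,1,2,3,3)] by simp

text \<open>
  The polynomial \<open>t \<mapsto> (u - t v, u - t v)\<close> is nonnegative, so its discriminant is not positive; when
  \<open>(v, v) = 0\<close> it is affine, which forces \<open>(u, v) = 0\<close>.
\<close>

lemma L2_Cauchy_Schwarz:
  assumes "u \<in> L2 \<Omega>" "v \<in> L2 \<Omega>"
  shows "\<bar>L2_inner \<Omega> u v\<bar> \<le> L2_norm \<Omega> u * L2_norm \<Omega> v"
proof -
  define A B C where "A = L2_inner \<Omega> u u" and "B = L2_inner \<Omega> u v" and "C = L2_inner \<Omega> v v"
  have q: "0 \<le> A - 2 * t * B + t * t * C" for t
  proof -
    let ?w = "\<lambda>x. 1 *\<^sub>R u x + (- t) *\<^sub>R v x"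
    have w: "?w \<in> L2 \<Omega>" by (rule L2_lincomb[OF assms])
    have "L2_inner \<Omega> ?w ?w = 1 * L2_inner \<Omega> u ?w + (- t) * L2_inner \<Omega> v ?w"
      by (rule L2_inner_lincomb_left[OF assms w])
    also have "L2_inner \<Omega> u ?w = 1 * L2_inner \<Omega> u u + (- t) * L2_inner \<Omega> v u"
      by (subst L2_inner_commute, rule L2_inner_lincomb_left[OF assms assms(1)])
    also have "L2_inner \<Omega> v ?w = 1 * L2_inner \<Omega> u v + (- t) * L2_inner \<Omega> v v"
      by (subst L2_inner_commute, rule L2_inner_lincomb_left[OF assms assms(2)])
    finally have "L2_inner \<Omega> ?w ?w = A - 2 * t * B + t * t * C"
      using L2_inner_commute[of \<Omega> u v] by (simp add: A_def B_def C_def algebra_simps)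
    with L2_inner_self_nonneg[of \<Omega> ?w] show ?thesis by simp
  qed
  have C: "C \<ge> 0" "A \<ge> 0" by (auto simp: C_def A_def L2_inner_self_nonneg)
  have "B * B \<le> A * C"
  proof (cases "C = 0")
    case True
    have "B = 0"
    proof (rule ccontr)
      assume "B \<noteq> 0"
      with q[of "(A + 1) / (2 * B)"] True show False by simp
    qed
    with True show ?thesis by simp
  next
    case False
    then have "0 \<le> A - B * B / C" using q[of "B / C"] by (simp add: field_simps)
    with False C show ?thesis by (simp add: field_simps)
  qed
  then have "\<bar>B\<bar> \<le> sqrt (A * C)"
    by (intro real_le_rsqrt) (simp add: power2_eq_square)
  then show ?thesis by (simp add: L2_norm_def A_def B_def C_def real_sqrt_mult)
qed

lemma L2_norm_triangle:
  assumes "u \<in> L2 \<Omega>" "v \<in> L2 \<Omega>"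
  shows "L2_norm \<Omega> (\<lambda>x. a *\<^sub>R u x + b *\<^sub>R v x) \<le> \<bar>a\<bar> * L2_norm \<Omega> u + \<bar>b\<bar> * L2_norm \<Omega> v"
proof (rule power2_le_imp_le)
  let ?w = "\<lambda>x. a *\<^sub>R u x + b *\<^sub>R v x"
  have w: "?w \<in> L2 \<Omega>" by (rule L2_lincomb[OF assms])
  have "L2_inner \<Omega> ?w ?w = a * L2_inner \<Omega> u ?w + b * L2_inner \<Omega> v ?w"
    by (rule L2_inner_lincomb_left[OF assms w])
  also have "L2_inner \<Omega> u ?w = a * L2_inner \<Omega> u u + b * L2_inner \<Omega> v u"
    by (subst L2_inner_commute, rule L2_inner_lincomb_left[OF assms assms(1)])
  also have "L2_inner \<Omega> v ?w = a * L2_inner \<Omega> u v + b * L2_inner \<Omega> v v"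
    by (subst L2_inner_commute, rule L2_inner_lincomb_left[OF assms assms(2)])
  finally have eq: "(L2_norm \<Omega> ?w)\<^sup>2
      = a\<^sup>2 * (L2_norm \<Omega> u)\<^sup>2 + 2 * (a * b * L2_inner \<Omega> u v) + b\<^sup>2 * (L2_norm \<Omega> v)\<^sup>2"
    using L2_inner_commute[of \<Omega> u v]
    unfolding L2_norm_power2 by (simp add: power2_eq_square algebra_simps)
  have "a * b * L2_inner \<Omega> u v \<le> \<bar>a\<bar> * \<bar>b\<bar> * \<bar>L2_inner \<Omega> u v\<bar>"
    by (metis abs_ge_self abs_mult)
  also have "\<dots> \<le> \<bar>a\<bar> * \<bar>b\<bar> * (L2_norm \<Omega> u * L2_norm \<Omega> v)"
    by (intro mult_left_mono L2_Cauchy_Schwarz[OF assms]) auto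
  finally show "(L2_norm \<Omega> ?w)\<^sup>2 \<le> (\<bar>a\<bar> * L2_norm \<Omega> u + \<bar>b\<bar> * L2_norm \<Omega> v)\<^sup>2"
    unfolding eq by (simp add: power2_sum power_mult_distrib algebra_simps)
qed (simp add: L2_norm_nonneg)

lemma L2_vec_nth: "(u :: _ \<Rightarrow> 'b::euclidean_space^'n) \<in> L2 \<Omega> \<Longrightarrow> (\<lambda>x. u x $ i) \<in> L2 \<Omega>"
proof -
  assume u: "u \<in> L2 \<Omega>"
  have m: "(\<lambda>x. u x $ i) \<in> borel_measurable (lebesgue_on \<Omega>)"
    by (rule measurable_compose[OF L2_measurable[OF u]])
       (intro borel_measurable_continuous_onI continuous_intros)
  have "integrable (lebesgue_on \<Omega>) (\<lambda>x. (norm (u x $ i))\<^sup>2)"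
  proof (rule Bochner_Integration.integrable_bound)
    show "integrable (lebesgue_on \<Omega>) (\<lambda>x. (norm (u x))\<^sup>2)" using u by (simp add: L2_def)
    show "(\<lambda>x. (norm (u x $ i))\<^sup>2) \<in> borel_measurable (lebesgue_on \<Omega>)" using m by measurable
    show "AE x in lebesgue_on \<Omega>. norm ((norm (u x $ i))\<^sup>2) \<le> norm ((norm (u x))\<^sup>2)"
      by (intro AE_I2) (simp add: Finite_Cartesian_Product.norm_nth_le power_mono)
  qed
  with m show ?thesis by (simp add: L2_def)
qed

lemma L2_vec_lambda:
  fixes u :: "'n::finite \<Rightarrow> (real^'d) \<Rightarrow> 'b::euclidean_space"
  assumes "\<And>i. u i \<in> L2 \<Omega>"
  shows "(\<lambda>x. \<chi> i. u i x) \<in> L2 \<Omega>"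
proof -
  have m: "(\<lambda>x. \<chi> i. u i x) \<in> borel_measurable (lebesgue_on \<Omega>)"
  proof (subst borel_measurable_euclidean_space, intro ballI)
    fix b :: "'b^'n" assume "b \<in> Basis"
    then obtain i c where "b = axis i c" by (auto simp: Basis_vec_def)
    then have "(\<lambda>x. (\<chi> i. u i x) \<bullet> b) = (\<lambda>x. u i x \<bullet> c)" by (auto simp: inner_axis)
    with L2_measurable[OF assms] show "(\<lambda>x. (\<chi> i. u i x) \<bullet> b) \<in> borel_measurable (lebesgue_on \<Omega>)"
      by simp
  qed
  have "(\<lambda>x. (norm (\<chi> i. u i x))\<^sup>2) = (\<lambda>x. \<Sum>i\<in>UNIV. (norm (u i x))\<^sup>2)"
    by (simp only: power2_norm_eq_inner inner_vec_def vec_lambda_beta)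
  with m assms show ?thesis by (auto simp: L2_def)
qed

section \<open>Smooth functions\<close>

lemma classical_grad_eqI:
  assumes "(\<phi> has_derivative D) (at x)"
  shows "classical_grad \<phi> x $ j = D (axis j 1)"
  using frechet_derivative_at[OF assms] by (simp add: classical_grad_def)

lemma has_derivative_classical_grad:
  fixes \<phi> :: "real^'d \<Rightarrow> real"
  assumes "\<phi> differentiable at x"
  shows "(\<phi> has_derivative (\<lambda>h. classical_grad \<phi> x \<bullet> h)) (at x)"
proof -
  let ?D = "frechet_derivative \<phi> (at x)"
  have D: "(\<phi> has_derivative ?D) (at x)" using assms by (simp add: frechet_derivative_works)
  have "?D h = classical_grad \<phi> x \<bullet> h" for h
  proof -
    have lin: "linear ?D" using D by (rule has_derivative_linear)
    have "?D h = ?D (\<Sum>j\<in>UNIV. (h $ j) *\<^sub>R axis j 1)"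
      using basis_expansion[of h] by (simp add: scalar_mult_eq_scaleR)
    also have "\<dots> = (\<Sum>j\<in>UNIV. h $ j * ?D (axis j 1))"
      by (simp add: linear_sum[OF lin] linear_scale[OF lin])
    finally show ?thesis by (simp add: classical_grad_def inner_vec_def mult.commute)
  qed
  then have "?D = (\<lambda>h. classical_grad \<phi> x \<bullet> h)" by blast
  with D show ?thesis by simp
qed

lemma C_k_Suc_imp_C_k: "C_k (Suc k) \<phi> \<Longrightarrow> C_k k \<phi>"
proof (induction k arbitrary: \<phi>)
  case 0
  then show ?case
    by (auto intro!: continuous_at_imp_continuous_on differentiable_imp_continuous_within)
next
  case (Suc k)
  then show ?case by (metis C_k.simps(2))
qed

lemma C_k_const: "C_k k (\<lambda>x::real^'d. c)"
proof (induction k arbitrary: c)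
  case (Suc k)
  have "classical_grad (\<lambda>x::real^'d. c) x $ j = 0" for x :: "real^'d" and j
    by (rule classical_grad_eqI) (rule derivative_intros)
  with Suc show ?case by simp
qed simp

lemma classical_grad_coordinate: "classical_grad (\<lambda>x::real^'d. x $ i) x $ j = (if i = j then 1 else 0)"
proof -
  have "((\<lambda>x::real^'d. x $ i) has_derivative (\<lambda>h. h $ i)) (at x)"
    by (rule bounded_linear_imp_has_derivative[OF bounded_linear_vec_nth])
  from classical_grad_eqI[OF this] show ?thesis by (simp add: axis_def)
qed

lemma C_k_coordinate: "C_k k (\<lambda>x::real^'d. x $ i)"
proof (cases k)
  case (Suc l)
  have "(\<lambda>x::real^'d. x $ i) differentiable at x" for x
    using bounded_linear_imp_has_derivative[OF bounded_linear_vec_nth] by (auto simp: differentiable_def)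
  with Suc show ?thesis by (simp add: classical_grad_coordinate C_k_const)
qed (simp add: continuous_intros)

lemma classical_grad_add:
  assumes "f differentiable at x" "g differentiable at x"
  shows "classical_grad (\<lambda>x::real^'d. f x + g x) x $ j = classical_grad f x $ j + classical_grad g x $ j"
  by (subst classical_grad_eqI[OF has_derivative_add[OF assms[THEN has_derivative_classical_grad]]])
     (simp add: inner_axis)

lemma classical_grad_mult:
  assumes "f differentiable at x" "g differentiable at x"
  shows "classical_grad (\<lambda>x::real^'d. f x * g x) x $ j
    = f x * classical_grad g x $ j + classical_grad f x $ j * g x"
  by (subst classical_grad_eqI[OF has_derivative_mult[OF assms[THEN has_derivative_classical_grad]]])
     (simp add: inner_axis)

lemma classical_grad_compose:
  assumes "(h has_real_derivative h') (at (f x))" "f differentiable at x"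
  shows "classical_grad (\<lambda>x::real^'d. h (f x)) x $ j = h' * classical_grad f x $ j"
  by (subst classical_grad_eqI[OF has_derivative_compose[OF has_derivative_classical_grad[OF assms(2)]
        assms(1)[unfolded has_field_derivative_def]]]) (simp add: inner_axis)

lemma C_k_add: "C_k k f \<Longrightarrow> C_k k g \<Longrightarrow> C_k k (\<lambda>x::real^'d. f x + g x)"
  by (induction k arbitrary: f g) (auto simp: classical_grad_add intro: continuous_intros)

lemma C_k_mult: "C_k k f \<Longrightarrow> C_k k g \<Longrightarrow> C_k k (\<lambda>x::real^'d. f x * g x)"
proof (induction k arbitrary: f g)
  case (Suc k)
  have "C_k k (\<lambda>x. f x * classical_grad g x $ j + classical_grad f x $ j * g x)" for j
    using Suc.prems Suc.prems[THEN C_k_Suc_imp_C_k] by (intro C_k_add Suc.IH) auto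
  moreover have "(\<lambda>x. classical_grad (\<lambda>x. f x * g x) x $ j)
      = (\<lambda>x. f x * classical_grad g x $ j + classical_grad f x $ j * g x)" for j
    using Suc.prems by (auto simp: classical_grad_mult)
  ultimately show ?case using Suc.prems by simp
qed (auto intro: continuous_intros)

lemma C_k_sum: "(\<And>i. i \<in> I \<Longrightarrow> C_k k (f i)) \<Longrightarrow> C_k k (\<lambda>x::real^'d. \<Sum>i\<in>I. f i x)"
  by (induction I rule: infinite_finite_induct) (auto simp: C_k_const C_k_add)

lemma C_k_prod: "(\<And>i. i \<in> I \<Longrightarrow> C_k k (f i)) \<Longrightarrow> C_k k (\<lambda>x::real^'d. \<Prod>i\<in>I. f i x)"
  by (induction I rule: infinite_finite_induct) (auto simp: C_k_const C_k_mult)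

text \<open>
  The flat function \<open>exp (- 1 / t)\<close>, extended by zero to \<open>t \<le> 0\<close>, is the source of all bump functions. Its
  products with powers of \<open>1 / t\<close> are included because the resulting family is closed under
  differentiation.
\<close>

definition flat_exp :: "nat \<Rightarrow> real \<Rightarrow> real" where
  "flat_exp m t = (if t > 0 then inverse t ^ m * exp (- inverse t) else 0)"

lemma flat_exp_pos_iff: "0 < flat_exp m t \<longleftrightarrow> 0 < t"
  by (simp add: flat_exp_def)

lemma flat_exp_tendsto_0: "(flat_exp m \<longlongrightarrow> 0) (at 0)"
proof -
  have "((\<lambda>s::real. s ^ m / exp s) \<longlongrightarrow> 0) at_top" by (rule tendsto_power_div_exp_0)
  then have "((\<lambda>t::real. inverse t ^ m / exp (inverse t)) \<longlongrightarrow> 0) (at_right 0)"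
    by (rule filterlim_compose) (rule filterlim_inverse_at_top_right)
  then have "(flat_exp m \<longlongrightarrow> 0) (at_right 0)"
    by (rule Lim_transform_eventually)
       (auto simp: eventually_at_right_less flat_exp_def exp_minus divide_inverse
         intro!: eventually_mono[OF eventually_at_right_less[of 0]])
  moreover have "(flat_exp m \<longlongrightarrow> 0) (at_left 0)"
    by (rule Lim_transform_eventually[OF tendsto_const])
       (auto simp: flat_exp_def eventually_at_filter)
  ultimately show ?thesis by (simp add: filterlim_split_at)
qed

lemma flat_exp_has_derivative:
  "(flat_exp m has_real_derivative (flat_exp (m + 2) t - m * flat_exp (m + 1) t)) (at t)"
proof (cases t "0::real" rule: linorder_cases)
  case less
  have "(flat_exp m has_real_derivative 0) (at t)"
  proof (rule has_field_derivative_transform_within_open[where f = "\<lambda>_. 0" and S = "{..<0}"])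
    show "((\<lambda>_. 0) has_real_derivative 0) (at t)" by simp
  qed (use less in \<open>auto simp: flat_exp_def\<close>)
  with less show ?thesis by (simp add: flat_exp_def)
next
  case equal
  have "((\<lambda>h. (flat_exp m (0 + h) - flat_exp m 0) / h) \<longlongrightarrow> 0) (at 0)"
  proof (rule Lim_transform_eventually[OF flat_exp_tendsto_0[of "m + 1"]])
    show "\<forall>\<^sub>F h in at 0. flat_exp (m + 1) h = (flat_exp m (0 + h) - flat_exp m 0) / h"
      by (auto simp: flat_exp_def eventually_at_filter divide_inverse)
  qed
  with equal show ?thesis by (simp add: DERIV_def flat_exp_def)
next
  case greater
  have "((\<lambda>t. inverse t ^ m * exp (- inverse t)) has_real_derivative
      (flat_exp (m + 2) t - m * flat_exp (m + 1) t)) (at t)"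
    using greater
    by (auto intro!: derivative_eq_intros simp: flat_exp_def power2_eq_square)
       (cases m; simp add: field_simps power_Suc)
  then show ?thesis
    by (rule has_field_derivative_transform_within_open[where S = "{0<..}"])
       (use greater in \<open>auto simp: flat_exp_def\<close>)
qed

text \<open>
  Each derivative leads from the index \<open>m\<close> to \<open>m + 1\<close> and \<open>m + 2\<close>, so the induction on \<open>k\<close> has to treat
  all members of the family together.
\<close>

lemma C_k_flat_exp: "(\<And>l. C_k l f) \<Longrightarrow> C_k k (\<lambda>x::real^'d. flat_exp m (f x))"
proof (induction k arbitrary: m)
  case 0
  have "isCont (flat_exp m) t" for t by (rule DERIV_isCont[OF flat_exp_has_derivative])
  moreover have "continuous_on UNIV f" using 0[of 0] by simp
  ultimately show ?case
    by (simp add: continuous_on_eq_continuous_within isCont_o2)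
next
  case (Suc k)
  have d: "f differentiable at x" for x using Suc.prems[of 1] by simp
  have "C_k k (\<lambda>x. classical_grad f x $ j)" for j using Suc.prems[of "Suc k"] by simp
  then have "C_k k (\<lambda>x. (flat_exp (m + 2) (f x) + (- real m) * flat_exp (m + 1) (f x)) * classical_grad f x $ j)" for j
    by (intro C_k_mult C_k_add C_k_const Suc)
  moreover have "(\<lambda>x. flat_exp m (f x)) differentiable at x" for x
    using has_derivative_compose[OF has_derivative_classical_grad[OF d]
        flat_exp_has_derivative[unfolded has_field_derivative_def]]
    by (auto simp: differentiable_def)
  ultimately show ?case
    by (simp add: classical_grad_compose[OF flat_exp_has_derivative d])
qed

section \<open>Test functions and integration by parts\<close>

lemma has_real_derivative_along_axis:
  fixes \<phi> :: "real^'d \<Rightarrow> real"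
  assumes "\<phi> differentiable at (x + t *\<^sub>R axis j 1)"
  shows "((\<lambda>t. \<phi> (x + t *\<^sub>R axis j 1)) has_real_derivative
      classical_grad \<phi> (x + t *\<^sub>R axis j 1) $ j) (at t)"
proof -
  have "((\<lambda>t. x + t *\<^sub>R axis j 1) has_derivative (\<lambda>h. h *\<^sub>R axis j 1)) (at t)"
    by (auto intro!: derivative_eq_intros)
  from has_derivative_compose[OF this has_derivative_classical_grad[OF assms]]
  show ?thesis
    by (simp add: has_field_derivative_def inner_axis mult.commute[of _ "classical_grad _ _ $ _"])
qed

lemma test_functionsI:
  assumes "\<And>k. C_k k \<phi>" "compact K" "K \<subseteq> \<Omega>" "\<And>x. x \<notin> K \<Longrightarrow> \<phi> x = 0"
  shows "\<phi> \<in> test_functions \<Omega>"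
proof -
  have "closure {x. \<phi> x \<noteq> 0} \<subseteq> K"
    using assms(2,4) by (intro closure_minimal compact_imp_closed) auto
  moreover from this have "compact (closure {x. \<phi> x \<noteq> 0})"
    using assms(2) by (meson bounded_subset closed_closure compact_eq_bounded_closed)
  ultimately show ?thesis
    using assms(1,3) unfolding test_functions_def by blast
qed

text \<open>
  Off the closed support a test function vanishes on a neighbourhood, so its gradient vanishes there too.
\<close>

lemma test_functionsE:
  assumes "\<phi> \<in> test_functions \<Omega>"
  obtains K where "compact K" "K \<subseteq> \<Omega>" "\<And>x. x \<notin> K \<Longrightarrow> \<phi> x = 0"
    "\<And>x j. x \<notin> K \<Longrightarrow> classical_grad \<phi> x $ j = 0"
proof -
  let ?K = "closure {x. \<phi> x \<noteq> 0}"
  have K: "compact ?K" "?K \<subseteq> \<Omega>" using assms by (simp_all only: test_functions_def mem_Collect_eq)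
  have z: "\<phi> x = 0" if "x \<notin> ?K" for x using that closure_subset[of "{x. \<phi> x \<noteq> 0}"] by auto
  have "classical_grad \<phi> x $ j = 0" if "x \<notin> ?K" for x j
  proof -
    have "(\<phi> has_derivative (\<lambda>_. 0)) (at x)"
    proof (rule has_derivative_transform_within_open)
      show "((\<lambda>_. 0) has_derivative (\<lambda>_. 0)) (at x)" by simp
      show "open (- ?K)" "x \<in> - ?K" using that by auto
      show "0 = \<phi> y" if "y \<in> - ?K" for y using that z[of y] by simp
    qed
    from classical_grad_eqI[OF this] show ?thesis by simp
  qed
  with K z show ?thesis by (rule that)
qed

lemma test_functions_C_k: "\<phi> \<in> test_functions \<Omega> \<Longrightarrow> C_k k \<phi>"
  by (simp add: test_functions_def)

lemma C_k_continuous: "C_k k \<phi> \<Longrightarrow> continuous_on UNIV \<phi>"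
  by (induction k) (simp, blast dest: C_k_Suc_imp_C_k)

lemma test_functions_continuous: "\<phi> \<in> test_functions \<Omega> \<Longrightarrow> continuous_on UNIV \<phi>"
  by (rule C_k_continuous[OF test_functions_C_k])

lemma test_functions_differentiable: "\<phi> \<in> test_functions \<Omega> \<Longrightarrow> \<phi> differentiable at x"
  using test_functions_C_k[of \<phi> \<Omega> 1] by simp

lemma test_functions_zero: "\<phi> \<in> test_functions \<Omega> \<Longrightarrow> x \<notin> \<Omega> \<Longrightarrow> \<phi> x = 0"
  by (metis subsetD test_functionsE)

lemma test_functions_grad:
  assumes "\<phi> \<in> test_functions \<Omega>"
  shows "(\<lambda>x. classical_grad \<phi> x $ j) \<in> test_functions \<Omega>"
proof -
  from test_functionsE[OF assms] obtain K where K: "compact K" "K \<subseteq> \<Omega>"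
    "\<And>x j. x \<notin> K \<Longrightarrow> classical_grad \<phi> x $ j = 0" by metis
  have "C_k k (\<lambda>x. classical_grad \<phi> x $ j)" for k
    using test_functions_C_k[OF assms, of "Suc k"] by simp
  then show ?thesis using K by (rule test_functionsI)
qed

lemma test_functions_smooth_mult:
  assumes "\<phi> \<in> test_functions \<Omega>" "\<And>k. C_k k g"
  shows "(\<lambda>x. g x * \<phi> x) \<in> test_functions \<Omega>"
proof -
  from test_functionsE[OF assms(1)] obtain K where K: "compact K" "K \<subseteq> \<Omega>"
    "\<And>x. x \<notin> K \<Longrightarrow> \<phi> x = 0" by metis
  show ?thesis
    by (rule test_functionsI[OF C_k_mult[OF assms(2) test_functions_C_k[OF assms(1)]] K(1,2)])
       (simp add: K(3))
qed

lemma test_functions_lincomb: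
  assumes "\<phi> \<in> test_functions \<Omega>" "\<psi> \<in> test_functions \<Omega>"
  shows "(\<lambda>x. a * \<phi> x + b * \<psi> x) \<in> test_functions \<Omega>"
proof -
  from test_functionsE[OF assms(1)] obtain K where K: "compact K" "K \<subseteq> \<Omega>"
    "\<And>x. x \<notin> K \<Longrightarrow> \<phi> x = 0" by metis
  from test_functionsE[OF assms(2)] obtain L where L: "compact L" "L \<subseteq> \<Omega>"
    "\<And>x. x \<notin> L \<Longrightarrow> \<psi> x = 0" by metis
  show ?thesis
  proof (rule test_functionsI)
    show "C_k k (\<lambda>x. a * \<phi> x + b * \<psi> x)" for k
      by (intro C_k_add C_k_mult C_k_const test_functions_C_k[OF assms(1)]
          test_functions_C_k[OF assms(2)])
    show "compact (K \<union> L)" "K \<union> L \<subseteq> \<Omega>" using K(1,2) L(1,2) by auto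
    show "a * \<phi> x + b * \<psi> x = 0" if "x \<notin> K \<union> L" for x using that K(3) L(3) by simp
  qed
qed

lemma test_functions_classical_grad_lincomb:
  assumes "\<phi> \<in> test_functions \<Omega>" "\<psi> \<in> test_functions \<Omega>"
  shows "classical_grad (\<lambda>x. a * \<phi> x + b * \<psi> x) x = a *\<^sub>R classical_grad \<phi> x + b *\<^sub>R classical_grad \<psi> x"
proof -
  note d = test_functions_differentiable[OF assms(1)] test_functions_differentiable[OF assms(2)]
  have "((\<lambda>x. a * \<phi> x + b * \<psi> x) has_derivative
     (\<lambda>h. a * (classical_grad \<phi> x \<bullet> h) + b * (classical_grad \<psi> x \<bullet> h))) (at x)"
    by (intro has_derivative_add has_derivative_mult_right has_derivative_classical_grad d)
  from classical_grad_eqI[OF this] show ?thesis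
    by (simp add: vec_eq_iff inner_axis)
qed

lemma test_functions_integral:
  assumes "open \<Omega>" "\<phi> \<in> test_functions \<Omega>"
  shows "integrable lborel \<phi>" "integrable (lebesgue_on \<Omega>) \<phi>"
    "integral\<^sup>L (lebesgue_on \<Omega>) \<phi> = integral\<^sup>L lborel \<phi>"
proof -
  from test_functionsE[OF assms(2)] obtain K where K: "compact K" "K \<subseteq> \<Omega>"
    "\<And>x. x \<notin> K \<Longrightarrow> \<phi> x = 0" by metis
  have "continuous_on K \<phi>"
    using test_functions_continuous[OF assms(2)] continuous_on_subset by blast
  from borel_integrable_compact[OF K(1) this]
  show 1: "integrable lborel \<phi>"
    by (rule Bochner_Integration.integrable_cong[THEN iffD1, rotated 2])
       (use K in \<open>auto simp: indicator_def\<close>)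
  have ind: "(\<lambda>x. indicator \<Omega> x *\<^sub>R \<phi> x) = \<phi>"
  proof
    show "indicator \<Omega> x *\<^sub>R \<phi> x = \<phi> x" for x
      using test_functions_zero[OF assms(2), of x] by (cases "x \<in> \<Omega>") auto
  qed
  have leb: "\<Omega> \<inter> space lebesgue \<in> sets lebesgue" using assms(1) by (simp add: lebesgue_openin)
  show "integrable (lebesgue_on \<Omega>) \<phi>"
    unfolding integrable_restrict_space[OF leb] ind using 1 by (simp add: integrable_completion)
  show "integral\<^sup>L (lebesgue_on \<Omega>) \<phi> = integral\<^sup>L lborel \<phi>"
    unfolding integral_restrict_space[OF leb] ind using 1 by (simp add: integral_completion)
qed

lemma test_functions_L2:
  assumes "open \<Omega>" "\<phi> \<in> test_functions \<Omega>"
  shows "\<phi> \<in> L2 \<Omega>"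
proof -
  have "integrable (lebesgue_on \<Omega>) (\<lambda>x. \<phi> x * \<phi> x)"
    by (rule test_functions_integral(2)[OF assms(1)
          test_functions_smooth_mult[OF assms(2) test_functions_C_k[OF assms(2)]]])
  moreover have "\<phi> \<in> borel_measurable (lebesgue_on \<Omega>)"
    using test_functions_integral(2)[OF assms] by auto
  ultimately show ?thesis by (simp add: L2_def power2_eq_square)
qed

lemma test_functions_bounded:
  assumes "\<phi> \<in> test_functions \<Omega>"
  obtains B where "0 \<le> B" "\<And>x. \<bar>\<phi> x\<bar> \<le> B"
proof -
  from test_functionsE[OF assms] obtain K where K: "compact K" "\<And>x. x \<notin> K \<Longrightarrow> \<phi> x = 0" by metis
  have "compact (\<phi> ` K)"
    by (rule compact_continuous_image[OF continuous_on_subset[OF test_functions_continuous[OF assms]] K(1)]) auto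
  then obtain B where B: "0 < B" "\<forall>y\<in>\<phi> ` K. norm y \<le> B"
    using compact_imp_bounded bounded_pos by metis
  show ?thesis
  proof
    show "0 \<le> B" using B by simp
    show "\<bar>\<phi> x\<bar> \<le> B" for x using B K(2)[of x] by (cases "x \<in> K") auto
  qed
qed

text \<open>
  The integral of \<open>\<phi> (x + h e\<^sub>j) - \<phi> x\<close> is zero by translation invariance, and the difference quotients
  converge to \<open>\<partial>\<^sub>j \<phi>\<close> while staying bounded by a Lipschitz constant of \<open>\<phi>\<close> on a fixed ball.
\<close>

lemma integral_classical_grad_eq_0:
  fixes \<Omega> :: "(real^'d) set"
  assumes "\<phi> \<in> test_functions \<Omega>"
  shows "(\<integral>x. classical_grad \<phi> x $ j \<partial>lborel) = 0"
proof -
  let ?e = "axis j 1 :: real^'d"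
  let ?\<phi>' = "\<lambda>x. classical_grad \<phi> x $ j"
  define h where "h n = inverse (real (Suc n))" for n
  define s where "s n x = (\<phi> (h n *\<^sub>R ?e + x) - \<phi> x) / h n" for n x
  have h: "0 < h n" "h n \<le> 1" for n by (auto simp: h_def field_simps)
  have h0: "h \<longlonglongrightarrow> 0" unfolding h_def by (rule LIMSEQ_inverse_real_of_nat)
  have phiU: "\<phi> \<in> test_functions UNIV" using assms unfolding test_functions_def by blast
  have m: "\<phi> \<in> borel_measurable borel"
    by (rule borel_measurable_continuous_onI[OF test_functions_continuous[OF assms]])
  have m': "?\<phi>' \<in> borel_measurable borel"
    by (rule borel_measurable_continuous_onI[OF test_functions_continuous[OF test_functions_grad[OF assms]]])
  have int: "integrable lborel \<phi>" by (rule test_functions_integral(1)[OF open_UNIV phiU])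
  have tr: "integrable lborel (\<lambda>x. \<phi> (c + x))" "(\<integral>x. \<phi> (c + x) \<partial>lborel) = (\<integral>x. \<phi> x \<partial>lborel)" for c
  proof -
    have "integrable (distr lborel borel ((+) c)) \<phi>" using int by (simp add: lborel_distr_plus)
    then show "integrable lborel (\<lambda>x. \<phi> (c + x))" using m by (subst (asm) integrable_distr_eq) auto
    have "(\<integral>x. \<phi> x \<partial>lborel) = (\<integral>x. \<phi> x \<partial>distr lborel borel ((+) c))" by (simp add: lborel_distr_plus)
    also have "\<dots> = (\<integral>x. \<phi> (c + x) \<partial>lborel)" using m by (subst integral_distr) auto
    finally show "(\<integral>x. \<phi> (c + x) \<partial>lborel) = (\<integral>x. \<phi> x \<partial>lborel)" by simp
  qed
  have s0: "(\<integral>x. s n x \<partial>lborel) = 0" for n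
    unfolding s_def using tr int by simp
  obtain C where C: "0 \<le> C" "\<And>x. \<bar>?\<phi>' x\<bar> \<le> C"
    using test_functions_bounded[OF test_functions_grad[OF assms]] by metis
  from test_functionsE[OF assms] obtain K where K: "compact K" "\<And>x. x \<notin> K \<Longrightarrow> \<phi> x = 0" by metis
  obtain R where R: "\<And>x. x \<in> K \<Longrightarrow> norm x \<le> R"
    using compact_imp_bounded[OF K(1)] bounded_iff by metis
  have d: "((\<lambda>t. \<phi> (x + t *\<^sub>R ?e)) has_real_derivative ?\<phi>' (x + t *\<^sub>R ?e)) (at t)" for x t
    by (rule has_real_derivative_along_axis[OF test_functions_differentiable[OF assms]])
  \<comment> \<open>the mean value inequality along the direction \<open>e\<^sub>j\<close>\<close>
  have lip: "\<bar>\<phi> (t *\<^sub>R ?e + x) - \<phi> x\<bar> \<le> C * \<bar>t\<bar>" for t x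
    using field_differentiable_bound[of UNIV "\<lambda>t. \<phi> (x + t *\<^sub>R ?e)" "\<lambda>t. ?\<phi>' (x + t *\<^sub>R ?e)" C t 0] C d
    by (auto simp: add.commute has_field_derivative_at_within)
  have "(\<lambda>n. \<integral>x. s n x \<partial>lborel) \<longlonglongrightarrow> (\<integral>x. ?\<phi>' x \<partial>lborel)"
  proof (rule integral_dominated_convergence[where w = "\<lambda>x. C * indicator (cball 0 (R + 1)) x"])
    show "?\<phi>' \<in> borel_measurable lborel" using m' by simp
    show "s n \<in> borel_measurable lborel" for n
      unfolding s_def using m by measurable
    show "integrable lborel (\<lambda>x::real^'d. C * indicator (cball 0 (R + 1)) x)"
      by (intro integrable_mult_right integrable_real_indicator)
         (use emeasure_bounded_finite[of "cball (0::real^'d) (R + 1)"] in auto)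
    show "AE x in lborel. (\<lambda>n. s n x) \<longlonglongrightarrow> ?\<phi>' x"
    proof (rule AE_I2)
      fix x
      have "((\<lambda>t. (\<phi> (x + (0 + t) *\<^sub>R ?e) - \<phi> (x + 0 *\<^sub>R ?e)) / t) \<longlongrightarrow> ?\<phi>' (x + 0 *\<^sub>R ?e)) (at 0)"
        using d[of x 0] unfolding DERIV_def .
      moreover have "filterlim h (at 0) sequentially"
        using h0 h by (auto simp: filterlim_at intro!: always_eventually less_imp_neq[symmetric])
      ultimately have "((\<lambda>n. (\<phi> (x + (0 + h n) *\<^sub>R ?e) - \<phi> (x + 0 *\<^sub>R ?e)) / h n) \<longlongrightarrow> ?\<phi>' (x + 0 *\<^sub>R ?e)) sequentially"
        by (rule filterlim_compose)
      then show "(\<lambda>n. s n x) \<longlonglongrightarrow> ?\<phi>' x" by (simp add: s_def add.commute)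
    qed
    show "AE x in lborel. norm (s n x) \<le> C * indicator (cball 0 (R + 1)) x" for n
    proof (rule AE_I2)
      fix x :: "real^'d"
      show "norm (s n x) \<le> C * indicator (cball 0 (R + 1)) x"
      proof (cases "x \<in> cball 0 (R + 1)")
        case True
        then show ?thesis using lip[of "h n" x] h(1)[of n] by (simp add: s_def field_simps)
      next
        case False
        then have n: "R + 1 < norm x" by simp
        have "norm x \<le> norm (h n *\<^sub>R ?e + x) + norm (h n *\<^sub>R ?e)"
          by (metis add_diff_cancel_left' norm_triangle_ineq4 norm_minus_commute diff_add_cancel add.commute)
        also have "norm (h n *\<^sub>R ?e) \<le> 1" using h[of n] by (simp add: norm_axis_1)
        finally have "R < norm (h n *\<^sub>R ?e + x)" using n by simp
        then have "h n *\<^sub>R ?e + x \<notin> K" "x \<notin> K" using R[of x] R[of "h n *\<^sub>R ?e + x"] n by auto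
        then show ?thesis using K(2) False by (simp add: s_def)
      qed
    qed
  qed
  then have "(\<lambda>n. 0) \<longlonglongrightarrow> (\<integral>x. ?\<phi>' x \<partial>lborel)" by (simp add: s0)
  then show ?thesis using LIMSEQ_unique tendsto_const by metis
qed

text \<open>
  The product rule turns the vanishing integral of \<open>\<partial>\<^sub>j (\<phi> \<psi>)\<close> into integration by parts.
\<close>

lemma test_functions_by_parts:
  assumes "open \<Omega>" "\<phi> \<in> test_functions \<Omega>" "\<psi> \<in> test_functions \<Omega>"
  shows "L2_inner \<Omega> \<phi> (\<lambda>x. classical_grad \<psi> x $ j) = - L2_inner \<Omega> (\<lambda>x. classical_grad \<phi> x $ j) \<psi>"
proof -
  let ?p = "\<lambda>x. \<phi> x * \<psi> x"
  have p: "?p \<in> test_functions \<Omega>"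
    by (rule test_functions_smooth_mult[OF assms(3) test_functions_C_k[OF assms(2)]])
  have "0 = (\<integral>x. classical_grad ?p x $ j \<partial>lebesgue_on \<Omega>)"
    using test_functions_integral(3)[OF assms(1) test_functions_grad[OF p]]
      integral_classical_grad_eq_0[OF p] by simp
  also have "\<dots> = (\<integral>x. \<phi> x \<bullet> classical_grad \<psi> x $ j + classical_grad \<phi> x $ j \<bullet> \<psi> x \<partial>lebesgue_on \<Omega>)"
    by (simp add: classical_grad_mult[OF test_functions_differentiable[OF assms(2)]
          test_functions_differentiable[OF assms(3)]])
  also have "\<dots> = L2_inner \<Omega> \<phi> (\<lambda>x. classical_grad \<psi> x $ j) + L2_inner \<Omega> (\<lambda>x. classical_grad \<phi> x $ j) \<psi>"
    unfolding L2_inner_def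
    by (intro Bochner_Integration.integral_add L2_inner_integrable test_functions_L2
        test_functions_grad assms)
  finally show ?thesis by simp
qed

lemma classical_grad_L2:
  assumes "open \<Omega>" "\<phi> \<in> test_functions \<Omega>"
  shows "classical_grad \<phi> \<in> L2 \<Omega>"
  using L2_vec_lambda[of "\<lambda>j x. classical_grad \<phi> x $ j" \<Omega>]
    test_functions_L2[OF assms(1) test_functions_grad[OF assms(2)]] by simp

text \<open>
  Together with the uniqueness of weak gradients, this identifies the abstract gradient of a test
  function with the classical one.
\<close>

lemma has_weak_grad_classical_grad:
  assumes "open \<Omega>" "\<phi> \<in> test_functions \<Omega>"
  shows "has_weak_grad \<Omega> \<phi> (classical_grad \<phi>)"
  unfolding has_weak_grad_def
  using classical_grad_L2[OF assms] test_functions_by_parts[OF assms] by blast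

section \<open>The fundamental lemma of the calculus of variations\<close>

lemma flat_exp_0_bounds: "0 \<le> flat_exp 0 t" "flat_exp 0 t \<le> 1"
  by (auto simp: flat_exp_def)

lemma flat_exp_0_scaled_tendsto:
  "(\<lambda>n. flat_exp 0 (real (Suc n) * t)) \<longlonglongrightarrow> (if 0 < t then 1 else 0)"
proof (cases "0 < t")
  case True
  have "(\<lambda>n. exp (- (inverse (real (Suc n)) * inverse t))) \<longlonglongrightarrow> exp (- (0 * inverse t))"
    by (intro tendsto_intros LIMSEQ_inverse_real_of_nat)
  then show ?thesis
    using True by (simp add: flat_exp_def inverse_mult_distrib)
next
  case False
  then have "flat_exp 0 (real (Suc n) * t) = 0" for n
    by (auto simp: flat_exp_def zero_less_mult_iff simp del: of_nat_Suc)
  with False show ?thesis by simp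
qed

text \<open>
  The factor for the coordinate \<open>k\<close> is positive exactly for \<open>a\<^sub>k < x\<^sub>k < b\<^sub>k\<close>; the growing factor
  \<open>Suc n\<close> drives \<open>exp (- 1 / t)\<close> to \<open>1\<close> wherever \<open>t\<close> is positive, so these bumps converge to the
  indicator of the box.
\<close>

definition box_bump :: "nat \<Rightarrow> real^'d \<Rightarrow> real^'d \<Rightarrow> real^'d \<Rightarrow> real" where
  "box_bump n a b x = (\<Prod>k\<in>UNIV. flat_exp 0 (real (Suc n) * ((x $ k - a $ k) * (b $ k - x $ k))))"

text \<open>
  Outside the closed box some factor has a nonpositive argument and vanishes. This uses \<open>a\<^sub>k < b\<^sub>k\<close>: for
  reversed end points both \<open>x\<^sub>k - a\<^sub>k\<close> and \<open>b\<^sub>k - x\<^sub>k\<close> can be negative.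
\<close>

lemma box_bump_test_function:
  assumes "box a b \<noteq> {}" "cbox a b \<subseteq> \<Omega>"
  shows "box_bump n a b \<in> test_functions \<Omega>"
proof (rule test_functionsI)
  show "C_k k (box_bump n a b)" for k
  proof -
    have "C_k l (\<lambda>x::real^'a. real (Suc n) * ((x $ k + (- a $ k)) * (b $ k + (- 1) * x $ k)))" for l k
      by (intro C_k_mult C_k_add C_k_const C_k_coordinate)
    then have "C_k l (\<lambda>x::real^'a. real (Suc n) * ((x $ k - a $ k) * (b $ k - x $ k)))" for l k
      by simp
    then show ?thesis
      unfolding box_bump_def[abs_def] by (intro C_k_prod C_k_flat_exp)
  qed
  show "compact (cbox a b)" "cbox a b \<subseteq> \<Omega>" using assms(2) by auto
  show "box_bump n a b x = 0" if "x \<notin> cbox a b" for x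
  proof -
    from that obtain k where k: "x $ k < a $ k \<or> b $ k < x $ k"
      by (auto simp: mem_box_cart not_le)
    have "a $ k < b $ k"
      using assms(1) by (auto simp: interval_ne_empty_cart)
    with k have "(x $ k - a $ k) * (b $ k - x $ k) \<le> 0"
      by (auto simp: mult_le_0_iff)
    then have "real (Suc n) * ((x $ k - a $ k) * (b $ k - x $ k)) \<le> 0"
      by (simp add: mult_nonneg_nonpos del: of_nat_Suc)
    then have "flat_exp 0 (real (Suc n) * ((x $ k - a $ k) * (b $ k - x $ k))) = 0"
      by (simp add: flat_exp_def del: of_nat_Suc)
    then show ?thesis unfolding box_bump_def by (meson finite UNIV_I prod_zero)
  qed
qed

lemma box_bump_bounds: "0 \<le> box_bump n a b x" "box_bump n a b x \<le> 1"
  unfolding box_bump_def by (auto intro!: prod_nonneg prod_le_1 flat_exp_0_bounds)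

lemma box_bump_tendsto:
  assumes "box a b \<noteq> {}"
  shows "(\<lambda>n. box_bump n a b x) \<longlonglongrightarrow> indicator (box a b) x"
proof -
  have ab: "a $ k < b $ k" for k using assms by (auto simp: interval_ne_empty_cart)
  have pos: "0 < (x $ k - a $ k) * (b $ k - x $ k) \<longleftrightarrow> a $ k < x $ k \<and> x $ k < b $ k" for k
    using ab[of k] by (auto simp: zero_less_mult_iff)
  have "(\<lambda>n. box_bump n a b x) \<longlonglongrightarrow>
     (\<Prod>k\<in>UNIV. if 0 < (x $ k - a $ k) * (b $ k - x $ k) then 1 else 0)"
    unfolding box_bump_def by (intro tendsto_prod flat_exp_0_scaled_tendsto)
  also have "(\<Prod>k\<in>UNIV. if 0 < (x $ k - a $ k) * (b $ k - x $ k) then 1 else 0 :: real) = indicator (box a b) x"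
    unfolding pos by (auto simp: indicator_def mem_box_cart intro!: prod.neutral prod_zero)
  finally show ?thesis .
qed

lemma indicator_L2:
  assumes "open \<Omega>" "bounded A" "A \<in> sets borel"
  shows "(indicator A :: real^'d \<Rightarrow> real) \<in> L2 \<Omega>"
proof -
  have leb: "\<Omega> \<inter> space lebesgue \<in> sets lebesgue" using assms(1) by (simp add: lebesgue_openin)
  have "integrable lborel (indicator (A \<inter> \<Omega>) :: real^'d \<Rightarrow> real)"
    using assms emeasure_bounded_finite[of "A \<inter> \<Omega>"]
    by (intro integrable_real_indicator) (auto intro: bounded_subset)
  moreover have eq: "(\<lambda>x. indicator \<Omega> x *\<^sub>R indicator A x) = (indicator (A \<inter> \<Omega>) :: real^'d \<Rightarrow> real)"
    by (auto simp: indicator_def)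
  ultimately have "integrable (lebesgue_on \<Omega>) (indicator A :: real^'d \<Rightarrow> real)"
    unfolding integrable_restrict_space[OF leb] eq by (simp add: integrable_completion)
  moreover have "(\<lambda>x. (norm (indicator A x :: real))\<^sup>2) = indicator A" by (auto simp: indicator_def)
  ultimately show ?thesis by (simp add: L2_def)
qed

text \<open>
  The box bumps are test functions that converge to the indicator of the box and are dominated by the
  indicator of its closure.
\<close>

lemma L2_box_integral_eq_0:
  fixes \<Omega> :: "(real^'d) set" and h :: "real^'d \<Rightarrow> real"
  assumes "open \<Omega>" "h \<in> L2 \<Omega>"
    and orth: "\<And>\<phi>. \<phi> \<in> test_functions \<Omega> \<Longrightarrow> L2_inner \<Omega> h \<phi> = 0"
    and "cbox a b \<subseteq> \<Omega>"
  shows "L2_inner \<Omega> h (indicator (box a b)) = 0"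
proof (cases "box a b = {}")
  case False
  let ?\<phi> = "\<lambda>n. box_bump n a b"
  have t: "?\<phi> n \<in> test_functions \<Omega>" for n by (rule box_bump_test_function[OF False assms(4)])
  have ind: "(indicator (cbox a b) :: real^'d \<Rightarrow> real) \<in> L2 \<Omega>" "(indicator (box a b) :: real^'d \<Rightarrow> real) \<in> L2 \<Omega>"
    by (intro indicator_L2 assms(1); simp)+
  have "(\<lambda>n. L2_inner \<Omega> h (?\<phi> n)) \<longlonglongrightarrow> L2_inner \<Omega> h (indicator (box a b))"
    unfolding L2_inner_def
  proof (rule integral_dominated_convergence[where w = "\<lambda>x. norm (h x \<bullet> indicator (cbox a b) x)"])
    show "integrable (lebesgue_on \<Omega>) (\<lambda>x. norm (h x \<bullet> indicator (cbox a b) x))"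
      by (intro integrable_norm L2_inner_integrable assms(2) ind)
    show "AE x in lebesgue_on \<Omega>. (\<lambda>n. h x \<bullet> ?\<phi> n x) \<longlonglongrightarrow> h x \<bullet> indicator (box a b) x"
      by (intro AE_I2 tendsto_inner tendsto_const box_bump_tendsto[OF False])
    show "AE x in lebesgue_on \<Omega>. norm (h x \<bullet> ?\<phi> n x) \<le> norm (h x \<bullet> indicator (cbox a b) x)" for n
    proof (rule AE_I2)
      fix x
      have "box_bump n a b x = 0" if "x \<notin> cbox a b"
        using test_functions_zero[OF box_bump_test_function[OF False order.refl] that] .
      then show "norm (h x \<bullet> ?\<phi> n x) \<le> norm (h x \<bullet> indicator (cbox a b) x)"
        using box_bump_bounds[of n a b x]
        by (cases "x \<in> cbox a b") (auto simp: abs_mult mult_left_le)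
    qed
    show "(\<lambda>x. h x \<bullet> indicator (box a b) x) \<in> borel_measurable (lebesgue_on \<Omega>)"
      using L2_inner_integrable[OF assms(2) ind(2)] by (rule borel_measurable_integrable)
    show "(\<lambda>x. h x \<bullet> ?\<phi> n x) \<in> borel_measurable (lebesgue_on \<Omega>)" for n
      using L2_inner_integrable[OF assms(2) test_functions_L2[OF assms(1) t]]
      by (rule borel_measurable_integrable)
  qed
  then show ?thesis by (simp add: orth[OF t] LIMSEQ_const_iff)
qed (simp add: L2_inner_def)

text \<open>
  The sets with vanishing integral form a Dynkin system, and boxes are an intersection-stable generator of
  the Borel sets; a function whose integral vanishes over all Borel sets is zero almost everywhere.
\<close>

lemma box_integrals_0_imp_AE_0:
  fixes f :: "real^'d \<Rightarrow> real"
  assumes "integrable lborel f" "\<And>a b. (\<integral>x\<in>box a b. f x \<partial>lborel) = 0" "(\<integral>x. f x \<partial>lborel) = 0"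
  shows "AE x in lborel. f x = 0"
proof (rule sigma_finite_measure.density_zero[OF sigma_finite_lborel assms(1)])
  fix A :: "(real^'d) set" assume "A \<in> sets lborel"
  let ?B = "range (\<lambda>(a, b). box a b :: (real^'d) set)"
  have "sets (borel :: (real^'d) measure) = sigma_sets UNIV ?B"
    by (subst borel_eq_box) simp
  with \<open>A \<in> sets lborel\<close> have A: "A \<in> sigma_sets UNIV ?B" by simp
  have int: "set_integrable lborel B f" if "B \<in> sets borel" for B
    unfolding set_integrable_def using that assms(1) by (intro integrable_mult_indicator) auto
  have borel: "B \<in> sets borel" if "B \<in> sigma_sets UNIV ?B" for B
    using that \<open>sets borel = sigma_sets UNIV ?B\<close> by simp
  have stable: "Int_stable ?B"
    by (auto simp: Int_stable_def box_Int_box)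
  have sub: "?B \<subseteq> Pow UNIV" by simp
  show "(\<integral>x\<in>A. f x \<partial>lborel) = 0"
    using stable sub A
  proof (induction rule: sigma_sets_induct_disjoint)
    case (basic B)
    then show ?case using assms(2) by auto
  next
    case empty
    show ?case by (simp add: set_lebesgue_integral_def)
  next
    case (compl B)
    have "(\<integral>x\<in>B \<union> (UNIV - B). f x \<partial>lborel) = (\<integral>x\<in>B. f x \<partial>lborel) + (\<integral>x\<in>UNIV - B. f x \<partial>lborel)"
      using borel[OF compl(1)] by (intro set_integral_Un int) auto
    moreover have "(\<integral>x\<in>B \<union> (UNIV - B). f x \<partial>lborel) = 0"
      using assms(3) by (simp add: set_lebesgue_integral_def)
    ultimately show ?case using compl by simp
  next
    case (union B)
    have b: "B i \<in> sets borel" for i using union(2) borel by blast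
    have "(\<integral>x\<in>(\<Union>i. B i). f x \<partial>lborel) = (\<Sum>i. (\<integral>x\<in>B i. f x \<partial>lborel))"
      using union(1) b
      by (intro lebesgue_integral_countable_add int) (auto simp: disjoint_family_on_def)
    then show ?case using union by simp
  qed
qed

text \<open>
  The fundamental lemma of the calculus of variations. It is proved on each closed box inside \<open>\<Omega>\<close>, and
  \<open>\<Omega>\<close> is a countable union of such boxes. The Dynkin argument needs a Borel function, so \<open>h\<close> is
  first replaced by a Borel representative.
\<close>

lemma L2_orthogonal_test_functions_imp_AE_0:
  fixes \<Omega> :: "(real^'d) set" and h :: "real^'d \<Rightarrow> real"
  assumes "open \<Omega>" "h \<in> L2 \<Omega>"
    and orth: "\<And>\<phi>. \<phi> \<in> test_functions \<Omega> \<Longrightarrow> L2_inner \<Omega> h \<phi> = 0"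
  shows "AE x in lebesgue_on \<Omega>. h x = 0"
proof -
  have leb: "\<Omega> \<inter> space lebesgue \<in> sets lebesgue" using assms(1) by (simp add: lebesgue_openin)
  have "(\<lambda>x. indicator \<Omega> x *\<^sub>R h x) \<in> borel_measurable lebesgue"
    using L2_measurable[OF assms(2)] leb
    by (subst (asm) borel_measurable_restrict_space_iff) auto
  then obtain g where g: "g \<in> borel_measurable lborel" "AE x in lborel. indicator \<Omega> x *\<^sub>R h x = g x"
    using completion_ex_borel_measurable_real by blast
  have key: "AE x in lebesgue. x \<in> cbox c d \<longrightarrow> h x = 0" if "cbox c d \<subseteq> \<Omega>" for c d
  proof -
    let ?f = "\<lambda>x. indicator (box c d) x *\<^sub>R g x"
    have ind: "(indicator (box a b) :: real^'d \<Rightarrow> real) \<in> L2 \<Omega>" for a b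
      by (intro indicator_L2 assms(1)) simp_all
    have g_box: "integrable lborel (\<lambda>x. indicator (box a b) x *\<^sub>R g x)
        \<and> (\<integral>x. indicator (box a b) x *\<^sub>R g x \<partial>lborel) = 0" if "cbox a b \<subseteq> \<Omega> \<or> box a b = {}" for a b
    proof (cases "box a b = {}")
      case False
      with that have sub: "cbox a b \<subseteq> \<Omega>" by simp
      let ?h = "\<lambda>x. h x \<bullet> indicator (box a b) x"
      have m: "(\<lambda>x. indicator (box a b) x *\<^sub>R g x) \<in> borel_measurable lborel"
        using g(1) by measurable
      have ae: "AE x in lebesgue. indicator \<Omega> x *\<^sub>R ?h x = indicator (box a b) x *\<^sub>R g x"
        using AE_completion[OF g(2)] by eventually_elim (auto simp: indicator_def)
      have i: "integrable (lebesgue_on \<Omega>) ?h" by (rule L2_inner_integrable[OF assms(2) ind])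
      then have i': "integrable lebesgue (\<lambda>x. indicator \<Omega> x *\<^sub>R ?h x)"
        by (simp only: integrable_restrict_space[OF leb])
      have m': "(\<lambda>x. indicator (box a b) x *\<^sub>R g x) \<in> borel_measurable lebesgue"
        using m by (rule measurable_completion)
      have "integrable lebesgue (\<lambda>x. indicator (box a b) x *\<^sub>R g x)"
        using integrable_cong_AE[OF borel_measurable_integrable[OF i'] m' ae] i' by simp
      moreover have "(\<integral>x. indicator (box a b) x *\<^sub>R g x \<partial>lebesgue) = (\<integral>x. indicator \<Omega> x *\<^sub>R ?h x \<partial>lebesgue)"
        using integral_cong_AE[OF borel_measurable_integrable[OF i'] m' ae] by simp
      moreover have "(\<integral>x. indicator \<Omega> x *\<^sub>R ?h x \<partial>lebesgue) = 0"
        using L2_box_integral_eq_0[OF assms sub] unfolding L2_inner_def integral_restrict_space[OF leb]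
        by simp
      ultimately show ?thesis
        using m by (simp add: integrable_completion integral_completion)
    qed simp
    have "AE x in lborel. ?f x = 0"
    proof (rule box_integrals_0_imp_AE_0)
      show "integrable lborel ?f" by (rule g_box[OF disjI1[OF that], THEN conjunct1])
      show "(\<integral>x. ?f x \<partial>lborel) = 0" by (rule g_box[OF disjI1[OF that], THEN conjunct2])
      show "(\<integral>x\<in>box a b. ?f x \<partial>lborel) = 0" for a b
      proof -
        obtain p q where pq: "box a b \<inter> box c d = box p q"
          using box_Int_box[of a b c d] by (rule that)
        have "cbox p q \<subseteq> \<Omega> \<or> box p q = {}"
        proof (cases "box p q = {}")
          case False
          then have "cbox p q = closure (box p q)" by (simp add: closure_box)
          also have "\<dots> \<subseteq> closure (cbox c d)"
            using pq box_subset_cbox[of c d] by (intro closure_mono) blast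
          finally have "cbox p q \<subseteq> cbox c d" by simp
          with that show ?thesis by (intro disjI1) (rule subset_trans)
        qed simp
        from g_box[OF this] show ?thesis
          unfolding set_lebesgue_integral_def
          by (simp add: pq[symmetric] indicator_inter_arith mult.assoc)
      qed
    qed
    then have "AE x in lebesgue. ?f x = 0" by (rule AE_completion)
    moreover have "AE x in lebesgue. x \<notin> cbox c d - box c d"
      using negligible_frontier_interval[of c d] unfolding negligible_iff_null_sets by (rule AE_not_in)
    ultimately show ?thesis
      using AE_completion[OF g(2)]
    proof eventually_elim
      case (elim x)
      then show ?case using that by (auto simp: indicator_def split: if_splits)
    qed
  qed
  obtain \<D> where D: "countable \<D>" "\<D> \<subseteq> Pow \<Omega>" "\<And>X. X \<in> \<D> \<Longrightarrow> \<exists>a b. X = cbox a b" "\<Union>\<D> = \<Omega>"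
    using open_countable_Union_open_cbox[OF assms(1)] by metis
  have "\<forall>X\<in>\<D>. AE x in lebesgue. x \<in> X \<longrightarrow> h x = 0"
    using D key by (metis PowD subsetD)
  then have "AE x in lebesgue. \<forall>X\<in>\<D>. x \<in> X \<longrightarrow> h x = 0"
    unfolding AE_ball_countable[OF D(1)] .
  then have "AE x in lebesgue. x \<in> \<Omega> \<longrightarrow> h x = 0"
    by eventually_elim (use D(4) in blast)
  then show ?thesis by (simp only: AE_restrict_space_iff[OF leb])
qed

section \<open>Weak gradients and the spaces of fields\<close>

lemma L2_orthogonal_vec_unique:
  fixes G H :: "real^'d \<Rightarrow> real^'d"
  assumes "open \<Omega>" "G \<in> L2 \<Omega>" "H \<in> L2 \<Omega>"
    and "\<And>\<phi> j. \<phi> \<in> test_functions \<Omega> \<Longrightarrow> L2_inner \<Omega> (\<lambda>x. G x $ j) \<phi> = L2_inner \<Omega> (\<lambda>x. H x $ j) \<phi>"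
  shows "ae_eq \<Omega> G H"
proof -
  have "AE x in lebesgue_on \<Omega>. G x $ j - H x $ j = 0" for j
  proof (rule L2_orthogonal_test_functions_imp_AE_0[OF assms(1)])
    show "(\<lambda>x. G x $ j - H x $ j) \<in> L2 \<Omega>" by (intro L2_diff L2_vec_nth assms(2,3))
    fix \<phi> assume "\<phi> \<in> test_functions \<Omega>"
    then show "L2_inner \<Omega> (\<lambda>x. G x $ j - H x $ j) \<phi> = 0"
      using L2_inner_diff_left[OF L2_vec_nth[OF assms(2)] L2_vec_nth[OF assms(3)] test_functions_L2[OF assms(1)]]
        assms(4) by simp
  qed
  then have "AE x in lebesgue_on \<Omega>. \<forall>j\<in>UNIV. G x $ j - H x $ j = 0"
    by (intro AE_finite_allI) auto
  then show ?thesis unfolding ae_eq_def by eventually_elim (simp add: vec_eq_iff)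
qed

text \<open>
  All weak gradients of \<open>u\<close> have the same inner products with test functions.
\<close>

lemma has_weak_grad_unique:
  assumes "open \<Omega>" "has_weak_grad \<Omega> u G" "has_weak_grad \<Omega> u H"
  shows "ae_eq \<Omega> G H"
  using assms by (intro L2_orthogonal_vec_unique) (auto simp: has_weak_grad_def)

lemma weak_grad_ae_eq:
  assumes "open \<Omega>" "has_weak_grad \<Omega> u G"
  shows "ae_eq \<Omega> (weak_grad \<Omega> u) G"
  unfolding weak_grad_def
  by (rule has_weak_grad_unique[OF assms(1) someI[of "has_weak_grad \<Omega> u"] assms(2)]) (rule assms(2))

lemma has_weak_grad_weak_grad: "u \<in> H1 \<Omega> \<Longrightarrow> has_weak_grad \<Omega> u (weak_grad \<Omega> u)"
  unfolding weak_grad_def by (rule someI_ex[of "has_weak_grad \<Omega> u"]) (simp add: H1_def)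

lemma weak_grad_L2: "u \<in> H1 \<Omega> \<Longrightarrow> weak_grad \<Omega> u \<in> L2 \<Omega>"
  using has_weak_grad_weak_grad by (auto simp: has_weak_grad_def)

lemma has_weak_grad_lincomb:
  assumes "open \<Omega>" "u \<in> L2 \<Omega>" "v \<in> L2 \<Omega>" "has_weak_grad \<Omega> u G" "has_weak_grad \<Omega> v H"
  shows "has_weak_grad \<Omega> (\<lambda>x. a * u x + b * v x) (\<lambda>x. a *\<^sub>R G x + b *\<^sub>R H x)"
  unfolding has_weak_grad_def
proof (intro conjI ballI allI)
  have GH: "G \<in> L2 \<Omega>" "H \<in> L2 \<Omega>" using assms by (auto simp: has_weak_grad_def)
  then show "(\<lambda>x. a *\<^sub>R G x + b *\<^sub>R H x) \<in> L2 \<Omega>" by (rule L2_lincomb)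
  fix \<phi> j assume \<phi>: "\<phi> \<in> test_functions \<Omega>"
  note \<phi>2 = test_functions_L2[OF assms(1) \<phi>] test_functions_L2[OF assms(1) test_functions_grad[OF \<phi>]]
  show "L2_inner \<Omega> (\<lambda>x. a * u x + b * v x) (\<lambda>x. classical_grad \<phi> x $ j)
      = - L2_inner \<Omega> (\<lambda>x. (a *\<^sub>R G x + b *\<^sub>R H x) $ j) \<phi>"
    using L2_inner_lincomb_left[OF assms(2,3) \<phi>2(2), of a b j]
      L2_inner_lincomb_left[OF L2_vec_nth[OF GH(1)] L2_vec_nth[OF GH(2)] \<phi>2(1), of a j b j]
      assms(4,5) \<phi>
    by (simp add: has_weak_grad_def)
qed

lemma L2_norm_eq_0: "ae_eq \<Omega> u (\<lambda>x. 0) \<Longrightarrow> L2_norm \<Omega> u = 0"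
proof -
  assume "ae_eq \<Omega> u (\<lambda>x. 0)"
  then have "L2_inner \<Omega> u u = 0"
    unfolding L2_inner_def ae_eq_def by (intro integral_eq_zero_AE) (auto elim: eventually_mono)
  then show ?thesis by (simp add: L2_norm_def)
qed

text \<open>
  Bounding the two norms separately is equivalent and suits the triangle inequality better than the sum
  of squares.
\<close>

lemma H10_iff:
  "u \<in> H10 \<Omega> \<longleftrightarrow> u \<in> H1 \<Omega> \<and> (\<forall>\<epsilon>>0. \<exists>\<phi>\<in>test_functions \<Omega>. L2_norm \<Omega> (\<lambda>x. u x - \<phi> x) < \<epsilon>
      \<and> L2_norm \<Omega> (\<lambda>x. weak_grad \<Omega> u x - classical_grad \<phi> x) < \<epsilon>)"
proof -
  have 1: "p < \<epsilon> \<and> q < \<epsilon>" if "p\<^sup>2 + q\<^sup>2 < \<epsilon>\<^sup>2" "0 < \<epsilon>" "0 \<le> p" "0 \<le> q" for p q \<epsilon> :: real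
  proof -
    have "p\<^sup>2 < \<epsilon>\<^sup>2" "q\<^sup>2 < \<epsilon>\<^sup>2"
      using that(1) zero_le_power2[of p] zero_le_power2[of q] by linarith+
    then show ?thesis using that(2) by (auto intro: power2_less_imp_less)
  qed
  have 2: "p\<^sup>2 + q\<^sup>2 < \<epsilon>\<^sup>2" if "p < \<epsilon> / 2" "q < \<epsilon> / 2" "0 < \<epsilon>" "0 \<le> p" "0 \<le> q" for p q \<epsilon> :: real
  proof -
    have "p\<^sup>2 < (\<epsilon> / 2)\<^sup>2" "q\<^sup>2 < (\<epsilon> / 2)\<^sup>2" using that by (auto intro: power_strict_mono)
    moreover have "(\<epsilon> / 2)\<^sup>2 + (\<epsilon> / 2)\<^sup>2 \<le> \<epsilon>\<^sup>2" by (simp add: power2_eq_square)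
    ultimately show ?thesis by linarith
  qed
  show ?thesis
    unfolding H10_def
  proof (intro iffI; clarsimp)
    fix \<epsilon> :: real
    assume "\<forall>\<epsilon>>0. \<exists>\<phi>\<in>test_functions \<Omega>. (L2_norm \<Omega> (\<lambda>x. u x - \<phi> x))\<^sup>2
      + (L2_norm \<Omega> (\<lambda>x. weak_grad \<Omega> u x - classical_grad \<phi> x))\<^sup>2 < \<epsilon>\<^sup>2" "0 < \<epsilon>"
    then show "\<exists>\<phi>\<in>test_functions \<Omega>. L2_norm \<Omega> (\<lambda>x. u x - \<phi> x) < \<epsilon>
      \<and> L2_norm \<Omega> (\<lambda>x. weak_grad \<Omega> u x - classical_grad \<phi> x) < \<epsilon>"
      using 1 L2_norm_nonneg by meson
  next
    fix \<epsilon> :: real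
    assume "\<forall>\<epsilon>>0. \<exists>\<phi>\<in>test_functions \<Omega>. L2_norm \<Omega> (\<lambda>x. u x - \<phi> x) < \<epsilon>
      \<and> L2_norm \<Omega> (\<lambda>x. weak_grad \<Omega> u x - classical_grad \<phi> x) < \<epsilon>" "0 < \<epsilon>"
    then obtain \<phi> where "\<phi> \<in> test_functions \<Omega>" "L2_norm \<Omega> (\<lambda>x. u x - \<phi> x) < \<epsilon> / 2"
      "L2_norm \<Omega> (\<lambda>x. weak_grad \<Omega> u x - classical_grad \<phi> x) < \<epsilon> / 2"
      using half_gt_zero by blast
    then show "\<exists>\<phi>\<in>test_functions \<Omega>. (L2_norm \<Omega> (\<lambda>x. u x - \<phi> x))\<^sup>2
      + (L2_norm \<Omega> (\<lambda>x. weak_grad \<Omega> u x - classical_grad \<phi> x))\<^sup>2 < \<epsilon>\<^sup>2"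
      using 2[OF _ _ \<open>0 < \<epsilon>\<close> L2_norm_nonneg L2_norm_nonneg] by (intro bexI[of _ \<phi>])
  qed
qed

lemma test_functions_H10:
  assumes "open \<Omega>" "\<phi> \<in> test_functions \<Omega>"
  shows "\<phi> \<in> H10 \<Omega>"
proof -
  note w = has_weak_grad_classical_grad[OF assms]
  have "ae_eq \<Omega> (\<lambda>x. weak_grad \<Omega> \<phi> x - classical_grad \<phi> x) (\<lambda>x. 0)"
    using weak_grad_ae_eq[OF assms(1) w] by (simp add: ae_eq_def)
  from L2_norm_eq_0[OF this] have "L2_norm \<Omega> (\<lambda>x. weak_grad \<Omega> \<phi> x - classical_grad \<phi> x) = 0" .
  moreover have "L2_norm \<Omega> (\<lambda>x. \<phi> x - \<phi> x) = 0" by (simp add: L2_norm_def L2_inner_def)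
  ultimately show ?thesis
    unfolding H10_iff using w test_functions_L2[OF assms] assms(2)
    by (auto simp: H1_def intro!: bexI[of _ \<phi>])
qed

lemma H10_imp_H1: "u \<in> H10 \<Omega> \<Longrightarrow> u \<in> H1 \<Omega>"
  by (simp add: H10_def)

lemma H10_imp_L2: "u \<in> H10 \<Omega> \<Longrightarrow> u \<in> L2 \<Omega>"
  by (simp add: H10_def H1_def)

lemma weak_grad_lincomb:
  assumes "open \<Omega>" "u \<in> H1 \<Omega>" "v \<in> H1 \<Omega>"
  shows "(\<lambda>x. a * u x + b * v x) \<in> H1 \<Omega>"
    and "ae_eq \<Omega> (weak_grad \<Omega> (\<lambda>x. a * u x + b * v x)) (\<lambda>x. a *\<^sub>R weak_grad \<Omega> u x + b *\<^sub>R weak_grad \<Omega> v x)"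
proof -
  have uv: "u \<in> L2 \<Omega>" "v \<in> L2 \<Omega>" using assms by (auto simp: H1_def)
  note w = has_weak_grad_lincomb[OF assms(1) uv assms(2,3)[THEN has_weak_grad_weak_grad], of a b]
  from w L2_lincomb[OF uv, of a b] show "(\<lambda>x. a * u x + b * v x) \<in> H1 \<Omega>"
    by (auto simp: H1_def)
  from weak_grad_ae_eq[OF assms(1) w]
  show "ae_eq \<Omega> (weak_grad \<Omega> (\<lambda>x. a * u x + b * v x)) (\<lambda>x. a *\<^sub>R weak_grad \<Omega> u x + b *\<^sub>R weak_grad \<Omega> v x)" .
qed

text \<open>
  Linear combinations of approximating test functions approximate the linear combination; linearity of the
  weak gradient up to null sets is what makes the gradients match.
\<close>

lemma H10_lincomb:
  assumes "open \<Omega>" "u \<in> H10 \<Omega>" "v \<in> H10 \<Omega>"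
  shows "(\<lambda>x. a * u x + b * v x) \<in> H10 \<Omega>"
  unfolding H10_iff
proof (intro conjI allI impI)
  let ?w = "\<lambda>x. a * u x + b * v x"
  note H1 = assms(2,3)[THEN H10_imp_H1] and L2 = assms(2,3)[THEN H10_imp_L2]
  note lin = weak_grad_lincomb[OF assms(1) H1, of a b]
  show "?w \<in> H1 \<Omega>" by (rule lin)
  fix \<epsilon> :: real assume "0 < \<epsilon>"
  define \<delta> where "\<delta> = \<epsilon> / (\<bar>a\<bar> + \<bar>b\<bar> + 1)"
  have \<delta>: "0 < \<delta>" "(\<bar>a\<bar> + \<bar>b\<bar>) * \<delta> < \<epsilon>"
    using \<open>0 < \<epsilon>\<close> by (auto simp: \<delta>_def field_simps intro!: divide_pos_pos add_nonneg_pos)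
  obtain \<phi> where \<phi>: "\<phi> \<in> test_functions \<Omega>" "L2_norm \<Omega> (\<lambda>x. u x - \<phi> x) < \<delta>"
    "L2_norm \<Omega> (\<lambda>x. weak_grad \<Omega> u x - classical_grad \<phi> x) < \<delta>"
    using assms(2) \<delta>(1) unfolding H10_iff by blast
  obtain \<psi> where \<psi>: "\<psi> \<in> test_functions \<Omega>" "L2_norm \<Omega> (\<lambda>x. v x - \<psi> x) < \<delta>"
    "L2_norm \<Omega> (\<lambda>x. weak_grad \<Omega> v x - classical_grad \<psi> x) < \<delta>"
    using assms(3) \<delta>(1) unfolding H10_iff by blast
  let ?\<theta> = "\<lambda>x. a * \<phi> x + b * \<psi> x"
  have small: "\<bar>a\<bar> * p + \<bar>b\<bar> * q < \<epsilon>" if "p < \<delta>" "q < \<delta>" for p q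
    using mult_left_mono[of p \<delta> "\<bar>a\<bar>"] mult_left_mono[of q \<delta> "\<bar>b\<bar>"] that \<delta>(2)
    by (simp add: algebra_simps)
  have \<theta>: "?\<theta> \<in> test_functions \<Omega>" by (rule test_functions_lincomb[OF \<phi>(1) \<psi>(1)])
  have "L2_norm \<Omega> (\<lambda>x. a *\<^sub>R (u x - \<phi> x) + b *\<^sub>R (v x - \<psi> x))
      \<le> \<bar>a\<bar> * L2_norm \<Omega> (\<lambda>x. u x - \<phi> x) + \<bar>b\<bar> * L2_norm \<Omega> (\<lambda>x. v x - \<psi> x)"
    by (intro L2_norm_triangle L2_diff L2 test_functions_L2[OF assms(1)] \<phi>(1) \<psi>(1))
  also have "\<dots> < \<epsilon>" by (rule small[OF \<phi>(2) \<psi>(2)])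
  also have "(\<lambda>x. a *\<^sub>R (u x - \<phi> x) + b *\<^sub>R (v x - \<psi> x)) = (\<lambda>x. ?w x - ?\<theta> x)"
    by (simp add: algebra_simps)
  finally have A: "L2_norm \<Omega> (\<lambda>x. ?w x - ?\<theta> x) < \<epsilon>" .
  let ?d = "\<lambda>x. a *\<^sub>R (weak_grad \<Omega> u x - classical_grad \<phi> x) + b *\<^sub>R (weak_grad \<Omega> v x - classical_grad \<psi> x)"
  note G2 = H1[THEN weak_grad_L2] and c2 = classical_grad_L2[OF assms(1) \<phi>(1)] classical_grad_L2[OF assms(1) \<psi>(1)]
  have "L2_norm \<Omega> ?d \<le> \<bar>a\<bar> * L2_norm \<Omega> (\<lambda>x. weak_grad \<Omega> u x - classical_grad \<phi> x)
      + \<bar>b\<bar> * L2_norm \<Omega> (\<lambda>x. weak_grad \<Omega> v x - classical_grad \<psi> x)"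
    by (intro L2_norm_triangle L2_diff G2 c2)
  also have "\<dots> < \<epsilon>" by (rule small[OF \<phi>(3) \<psi>(3)])
  also have "L2_norm \<Omega> ?d = L2_norm \<Omega> (\<lambda>x. weak_grad \<Omega> ?w x - classical_grad ?\<theta> x)"
  proof (rule L2_norm_cong)
    show "?d \<in> borel_measurable (lebesgue_on \<Omega>)"
      by (intro L2_measurable L2_lincomb L2_diff G2 c2)
    show "(\<lambda>x. weak_grad \<Omega> ?w x - classical_grad ?\<theta> x) \<in> borel_measurable (lebesgue_on \<Omega>)"
      by (intro L2_measurable L2_diff weak_grad_L2 lin classical_grad_L2 assms(1) \<theta>)
    show "ae_eq \<Omega> ?d (\<lambda>x. weak_grad \<Omega> ?w x - classical_grad ?\<theta> x)"
      using lin(2) unfolding ae_eq_def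
      by eventually_elim
         (simp add: test_functions_classical_grad_lincomb[OF \<phi>(1) \<psi>(1)] algebra_simps)
  qed
  finally have B: "L2_norm \<Omega> (\<lambda>x. weak_grad \<Omega> ?w x - classical_grad ?\<theta> x) < \<epsilon>" .
  from A B \<theta> show "\<exists>\<theta>\<in>test_functions \<Omega>. L2_norm \<Omega> (\<lambda>x. ?w x - \<theta> x) < \<epsilon>
     \<and> L2_norm \<Omega> (\<lambda>x. weak_grad \<Omega> ?w x - classical_grad \<theta> x) < \<epsilon>" by (intro bexI[of _ ?\<theta>] conjI)
qed

lemma X_space_lincomb:
  assumes "open \<Omega>" "u \<in> X_space \<Omega>" "v \<in> X_space \<Omega>"
  shows "(\<lambda>x. a *\<^sub>R u x + b *\<^sub>R v x) \<in> X_space \<Omega>"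
  using assms H10_lincomb[OF assms(1)] by (simp add: X_space_def)

lemma X_space_component: "u \<in> X_space \<Omega> \<Longrightarrow> (\<lambda>x. u x $ i) \<in> H10 \<Omega>"
  by (simp add: X_space_def)

lemma grad_L2: "u \<in> X_space \<Omega> \<Longrightarrow> grad \<Omega> u \<in> L2 \<Omega>"
  unfolding grad_def[abs_def] by (intro L2_vec_lambda weak_grad_L2 H10_imp_H1 X_space_component)

lemma grad_lincomb:
  assumes "open \<Omega>" "u \<in> X_space \<Omega>" "v \<in> X_space \<Omega>"
  shows "ae_eq \<Omega> (grad \<Omega> (\<lambda>x. a *\<^sub>R u x + b *\<^sub>R v x)) (\<lambda>x. a *\<^sub>R grad \<Omega> u x + b *\<^sub>R grad \<Omega> v x)"
proof -
  have "AE x in lebesgue_on \<Omega>. \<forall>i\<in>UNIV. weak_grad \<Omega> (\<lambda>x. a * u x $ i + b * v x $ i) x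
      = a *\<^sub>R weak_grad \<Omega> (\<lambda>x. u x $ i) x + b *\<^sub>R weak_grad \<Omega> (\<lambda>x. v x $ i) x"
    using weak_grad_lincomb(2)[OF assms(1) H10_imp_H1 H10_imp_H1, OF X_space_component[OF assms(2)] X_space_component[OF assms(3)]]
    by (intro AE_finite_allI) (auto simp: ae_eq_def)
  then show ?thesis unfolding ae_eq_def
    by eventually_elim (simp add: grad_def vec_eq_iff)
qed

lemma divergence_lincomb:
  assumes "open \<Omega>" "u \<in> X_space \<Omega>" "v \<in> X_space \<Omega>"
  shows "ae_eq \<Omega> (divergence \<Omega> (\<lambda>x. a *\<^sub>R u x + b *\<^sub>R v x)) (\<lambda>x. a *\<^sub>R divergence \<Omega> u x + b *\<^sub>R divergence \<Omega> v x)"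
  using grad_lincomb[OF assms, of a b] unfolding ae_eq_def
  by eventually_elim (simp add: divergence_def sum.distrib sum_distrib_left)

lemma L2_sum:
  assumes "\<And>i. i \<in> I \<Longrightarrow> u i \<in> L2 \<Omega>"
  shows "(\<lambda>x. \<Sum>i\<in>I. u i x) \<in> L2 \<Omega>"
  using assms
proof (induction I rule: infinite_finite_induct)
  case (insert i I)
  then show ?case using L2_lincomb[of "u i" \<Omega> "\<lambda>x. \<Sum>i\<in>I. u i x" 1 1] by simp
qed (simp_all add: L2_def)

lemma divergence_L2: "u \<in> X_space \<Omega> \<Longrightarrow> divergence \<Omega> u \<in> L2 \<Omega>"
  unfolding divergence_def[abs_def] by (intro L2_sum L2_vec_nth grad_L2)

lemma V_space_imp_X_space: "u \<in> V_space \<Omega> \<Longrightarrow> u \<in> X_space \<Omega>"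
  by (simp add: V_space_def)

lemma V_space_lincomb:
  assumes "open \<Omega>" "u \<in> V_space \<Omega>" "v \<in> V_space \<Omega>"
  shows "(\<lambda>x. a *\<^sub>R u x + b *\<^sub>R v x) \<in> V_space \<Omega>"
proof -
  note X = assms(2,3)[THEN V_space_imp_X_space]
  note d2 = X[THEN divergence_L2]
  have "L2_inner \<Omega> (divergence \<Omega> (\<lambda>x. a *\<^sub>R u x + b *\<^sub>R v x)) p = 0" if p: "p \<in> Q_space \<Omega>" for p
  proof -
    have p2: "p \<in> L2 \<Omega>" using p by (simp add: Q_space_def)
    have "L2_inner \<Omega> (divergence \<Omega> (\<lambda>x. a *\<^sub>R u x + b *\<^sub>R v x)) p
        = L2_inner \<Omega> (\<lambda>x. a *\<^sub>R divergence \<Omega> u x + b *\<^sub>R divergence \<Omega> v x) p"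
      by (intro L2_inner_cong L2_measurable p2 L2_lincomb d2 divergence_L2
          divergence_lincomb X_space_lincomb assms(1) X) (simp add: ae_eq_def)
    also have "\<dots> = 0"
      using L2_inner_lincomb_left[OF d2 p2] assms(2,3) p by (simp add: V_space_def)
    finally show ?thesis .
  qed
  with X_space_lincomb[OF assms(1) X] show ?thesis by (simp add: V_space_def)
qed

lemma L2_const:
  assumes "open \<Omega>" "bounded \<Omega>"
  shows "(\<lambda>x::real^'d. c :: real) \<in> L2 \<Omega>"
proof -
  have "emeasure lebesgue \<Omega> < \<infinity>" using emeasure_bounded_finite[OF assms(2)] assms(1)
    by (simp add: emeasure_completion)
  then have "finite_measure (lebesgue_on \<Omega>)"
    using assms(1) by (intro finite_measureI) (simp add: emeasure_restrict_space lebesgue_openin)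
  then show ?thesis by (simp add: L2_def finite_measure.integrable_const)
qed

text \<open>
  The integral of a partial derivative is continuous in the \<open>H\<^sup>1\<close> norm because \<open>\<Omega>\<close> has finite measure, and
  it vanishes for test functions.
\<close>

lemma H10_integral_weak_grad:
  assumes "open \<Omega>" "bounded \<Omega>" "u \<in> H10 \<Omega>"
  shows "L2_inner \<Omega> (\<lambda>x. weak_grad \<Omega> u x $ j) (\<lambda>x. 1) = 0"
proof -
  let ?I = "L2_inner \<Omega> (\<lambda>x. weak_grad \<Omega> u x $ j) (\<lambda>x. 1)"
  let ?N = "L2_norm \<Omega> (\<lambda>x. 1::real)"
  note one = L2_const[OF assms(1,2), of 1]
  note G2 = weak_grad_L2[OF H10_imp_H1[OF assms(3)]]
  have "\<bar>?I\<bar> \<le> 0 + \<epsilon>" if "0 < \<epsilon>" for \<epsilon>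
  proof -
    define \<delta> where "\<delta> = \<epsilon> / (?N + 1)"
    have \<delta>: "0 < \<delta>" "\<delta> * ?N \<le> \<epsilon>"
      using that L2_norm_nonneg[of \<Omega> "\<lambda>x. 1::real"]
      by (auto simp: \<delta>_def field_simps intro!: divide_pos_pos add_nonneg_pos)
    obtain \<phi> where \<phi>: "\<phi> \<in> test_functions \<Omega>"
      "L2_norm \<Omega> (\<lambda>x. weak_grad \<Omega> u x - classical_grad \<phi> x) < \<delta>"
      using assms(3) \<delta>(1) unfolding H10_iff by blast
    let ?d = "\<lambda>x. weak_grad \<Omega> u x - classical_grad \<phi> x"
    note c2 = classical_grad_L2[OF assms(1) \<phi>(1)]
    have d2: "?d \<in> L2 \<Omega>" by (intro L2_diff G2 c2)
    have "L2_inner \<Omega> (\<lambda>x. classical_grad \<phi> x $ j) (\<lambda>x. 1) = 0"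
      using test_functions_integral(3)[OF assms(1) test_functions_grad[OF \<phi>(1)]]
        integral_classical_grad_eq_0[OF \<phi>(1)] by (simp add: L2_inner_def)
    then have "?I = L2_inner \<Omega> (\<lambda>x. ?d x $ j) (\<lambda>x. 1)"
      using L2_inner_diff_left[OF L2_vec_nth[OF G2] L2_vec_nth[OF c2] one, of j j] by simp
    also have "\<bar>\<dots>\<bar> \<le> L2_norm \<Omega> (\<lambda>x. ?d x $ j) * ?N"
      by (rule L2_Cauchy_Schwarz[OF L2_vec_nth[OF d2] one])
    also have "\<dots> \<le> \<delta> * ?N"
    proof (intro mult_right_mono L2_norm_nonneg)
      have "L2_inner \<Omega> (\<lambda>x. ?d x $ j) (\<lambda>x. ?d x $ j) \<le> L2_inner \<Omega> ?d ?d"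
        unfolding L2_inner_def
      proof (intro integral_mono L2_inner_integrable L2_vec_nth d2)
        show "?d x $ j \<bullet> ?d x $ j \<le> ?d x \<bullet> ?d x" for x
          unfolding inner_vec_def by (rule member_le_sum) auto
      qed
      then show "L2_norm \<Omega> (\<lambda>x. ?d x $ j) \<le> \<delta>"
        using \<phi>(2) by (simp add: L2_norm_def) (smt (verit) real_sqrt_le_mono)
    qed
    finally show ?thesis using \<delta>(2) by simp
  qed
  then have "\<bar>?I\<bar> \<le> 0" by (rule field_le_epsilon)
  then show ?thesis by simp
qed

lemma L2_inner_sum_left:
  assumes "\<And>i. i \<in> I \<Longrightarrow> u i \<in> L2 \<Omega>" "v \<in> L2 \<Omega>"
  shows "L2_inner \<Omega> (\<lambda>x. \<Sum>i\<in>I. u i x) v = (\<Sum>i\<in>I. L2_inner \<Omega> (u i) v)"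
  unfolding L2_inner_def inner_sum_left
  by (intro Bochner_Integration.integral_sum L2_inner_integrable assms)

text \<open>
  The definition of \<open>V\<close> tests the divergence only with functions of mean zero. Constants may be added,
  since the divergence of a field vanishing on the boundary has mean zero itself; hence the divergence
  is orthogonal to all of \<open>L\<^sup>2\<close>.
\<close>

lemma V_space_divergence_orthogonal:
  assumes "open \<Omega>" "bounded \<Omega>" "\<Omega> \<noteq> {}" "v \<in> V_space \<Omega>" "p \<in> L2 \<Omega>"
  shows "L2_inner \<Omega> (divergence \<Omega> v) p = 0"
proof -
  note X = V_space_imp_X_space[OF assms(4)]
  note one = L2_const[OF assms(1,2), of 1]
  \<comment> \<open>the mean value of \<open>p\<close> over \<open>\<Omega>\<close>\<close>
  define c where "c = L2_inner \<Omega> p (\<lambda>x. 1) / L2_inner \<Omega> (\<lambda>x. 1) (\<lambda>x. 1::real)"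
  have "L2_inner \<Omega> (\<lambda>x. 1) (\<lambda>x. 1::real) = measure lebesgue \<Omega>"
    using assms(1) by (simp add: L2_inner_def measure_restrict_space lebesgue_openin)
  moreover have "measure lebesgue \<Omega> > 0"
  proof -
    have "\<not> negligible \<Omega>" using assms(1,3) open_not_negligible by blast
    moreover have "\<Omega> \<in> lmeasurable" using assms(1,2) by (simp add: lmeasurable_open)
    ultimately show ?thesis by (metis measure_nonneg negligible_iff_measure less_eq_real_def)
  qed
  ultimately have pos: "L2_inner \<Omega> (\<lambda>x. 1) (\<lambda>x. 1::real) > 0" by simp
  let ?q = "\<lambda>x. p x - c"
  note c2 = L2_const[OF assms(1,2), of c]
  have q2: "?q \<in> L2 \<Omega>" by (rule L2_diff[OF assms(5) c2])
  have "L2_inner \<Omega> (\<lambda>x. c) (\<lambda>x. 1) = c * L2_inner \<Omega> (\<lambda>x. 1) (\<lambda>x. 1::real)"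
    by (simp add: L2_inner_def)
  then have "L2_inner \<Omega> ?q (\<lambda>x. 1) = 0"
    using L2_inner_diff_left[OF assms(5) c2 one] pos by (simp add: c_def)
  then have "?q \<in> Q_space \<Omega>" using q2 by (simp add: Q_space_def L2_inner_def)
  then have 0: "L2_inner \<Omega> (divergence \<Omega> v) ?q = 0" using assms(4) by (simp add: V_space_def)
  have "L2_inner \<Omega> (divergence \<Omega> v) (\<lambda>x. 1) = (\<Sum>i\<in>UNIV. L2_inner \<Omega> (\<lambda>x. grad \<Omega> v x $ i $ i) (\<lambda>x. 1))"
    unfolding divergence_def[abs_def]
    by (intro L2_inner_sum_left L2_vec_nth grad_L2 X one)
  also have "\<dots> = 0"
    by (intro sum.neutral ballI)
       (simp add: grad_def H10_integral_weak_grad[OF assms(1,2) X_space_component[OF X]])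
  finally have "L2_inner \<Omega> (\<lambda>x. c) (divergence \<Omega> v) = 0"
    by (simp add: L2_inner_def mult.commute)
  moreover have "L2_inner \<Omega> ?q (divergence \<Omega> v) = L2_inner \<Omega> p (divergence \<Omega> v) - L2_inner \<Omega> (\<lambda>x. c) (divergence \<Omega> v)"
    by (rule L2_inner_diff_left[OF assms(5) c2 divergence_L2[OF X]])
  ultimately show ?thesis using 0 by (metis L2_inner_commute diff_zero)
qed

section \<open>Skew-symmetry of the convective form\<close>

lemma grad_norm_lincomb_le:
  assumes "open \<Omega>" "u \<in> X_space \<Omega>" "v \<in> X_space \<Omega>"
  shows "grad_norm \<Omega> (\<lambda>x. a *\<^sub>R u x + b *\<^sub>R v x) \<le> \<bar>a\<bar> * grad_norm \<Omega> u + \<bar>b\<bar> * grad_norm \<Omega> v"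
proof -
  have "grad_norm \<Omega> (\<lambda>x. a *\<^sub>R u x + b *\<^sub>R v x) = L2_norm \<Omega> (\<lambda>x. a *\<^sub>R grad \<Omega> u x + b *\<^sub>R grad \<Omega> v x)"
    by (intro L2_norm_cong L2_measurable L2_lincomb grad_L2 grad_lincomb X_space_lincomb assms)
  also have "\<dots> \<le> \<bar>a\<bar> * grad_norm \<Omega> u + \<bar>b\<bar> * grad_norm \<Omega> v"
    by (intro L2_norm_triangle grad_L2 assms)
  finally show ?thesis .
qed

lemma grad_inner_lincomb_left:
  assumes "open \<Omega>" "u \<in> X_space \<Omega>" "v \<in> X_space \<Omega>" "w \<in> X_space \<Omega>"
  shows "L2_inner \<Omega> (grad \<Omega> (\<lambda>x. a *\<^sub>R u x + b *\<^sub>R v x)) (grad \<Omega> w)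
    = a * L2_inner \<Omega> (grad \<Omega> u) (grad \<Omega> w) + b * L2_inner \<Omega> (grad \<Omega> v) (grad \<Omega> w)"
proof -
  have "L2_inner \<Omega> (grad \<Omega> (\<lambda>x. a *\<^sub>R u x + b *\<^sub>R v x)) (grad \<Omega> w)
      = L2_inner \<Omega> (\<lambda>x. a *\<^sub>R grad \<Omega> u x + b *\<^sub>R grad \<Omega> v x) (grad \<Omega> w)"
    by (intro L2_inner_cong L2_measurable L2_lincomb grad_L2 grad_lincomb X_space_lincomb assms)
       (simp add: ae_eq_def)
  also have "\<dots> = a * L2_inner \<Omega> (grad \<Omega> u) (grad \<Omega> w) + b * L2_inner \<Omega> (grad \<Omega> v) (grad \<Omega> w)"
    by (intro L2_inner_lincomb_left grad_L2 assms)
  finally show ?thesis .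
qed

lemma convection_integrable:
  assumes "convection_constant \<Omega> M" "v \<in> X_space \<Omega>" "w \<in> X_space \<Omega>" "\<psi> \<in> X_space \<Omega>"
  shows "integrable (lebesgue_on \<Omega>) (\<lambda>x. convect \<Omega> v w x \<bullet> \<psi> x)"
  using assms unfolding convection_constant_def by blast

text \<open>
  The convective form is trilinear. The integrability that comes with the constant \<open>M\<close> is what allows the
  integral to be split in each of the three arguments.
\<close>

lemma convection_lincomb_test:
  assumes "convection_constant \<Omega> M" "v \<in> X_space \<Omega>" "w \<in> X_space \<Omega>" "\<phi> \<in> X_space \<Omega>" "\<psi> \<in> X_space \<Omega>"
  shows "L2_inner \<Omega> (convect \<Omega> v w) (\<lambda>x. a *\<^sub>R \<phi> x + b *\<^sub>R \<psi> x)
    = a * L2_inner \<Omega> (convect \<Omega> v w) \<phi> + b * L2_inner \<Omega> (convect \<Omega> v w) \<psi>"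
  using convection_integrable[OF assms(1-4)] convection_integrable[OF assms(1-3,5)]
  by (simp add: L2_inner_def inner_add_right)

lemma convection_lincomb_advecting:
  assumes "convection_constant \<Omega> M" "u \<in> X_space \<Omega>" "v \<in> X_space \<Omega>" "w \<in> X_space \<Omega>" "\<psi> \<in> X_space \<Omega>"
  shows "L2_inner \<Omega> (convect \<Omega> (\<lambda>x. a *\<^sub>R u x + b *\<^sub>R v x) w) \<psi>
    = a * L2_inner \<Omega> (convect \<Omega> u w) \<psi> + b * L2_inner \<Omega> (convect \<Omega> v w) \<psi>"
proof -
  have "convect \<Omega> (\<lambda>x. a *\<^sub>R u x + b *\<^sub>R v x) w x = a *\<^sub>R convect \<Omega> u w x + b *\<^sub>R convect \<Omega> v w x" for x
    by (simp add: convect_def matrix_vector_right_distrib matrix_vector_mult_scaleR)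
  then show ?thesis
    using convection_integrable[OF assms(1,2,4,5)] convection_integrable[OF assms(1,3,4,5)]
    by (simp add: L2_inner_def inner_add_left)
qed

lemma convection_lincomb_advected:
  assumes "open \<Omega>" "convection_constant \<Omega> M"
    and "v \<in> X_space \<Omega>" "u \<in> X_space \<Omega>" "w \<in> X_space \<Omega>" "\<psi> \<in> X_space \<Omega>"
  shows "L2_inner \<Omega> (convect \<Omega> v (\<lambda>x. a *\<^sub>R u x + b *\<^sub>R w x)) \<psi>
    = a * L2_inner \<Omega> (convect \<Omega> v u) \<psi> + b * L2_inner \<Omega> (convect \<Omega> v w) \<psi>"
proof -
  note i = convection_integrable[OF assms(2,3,4,6)] convection_integrable[OF assms(2,3,5,6)]
    convection_integrable[OF assms(2,3) X_space_lincomb[OF assms(1,4,5), of a b] assms(6)]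
  have "L2_inner \<Omega> (convect \<Omega> v (\<lambda>x. a *\<^sub>R u x + b *\<^sub>R w x)) \<psi>
      = (\<integral>x. a * (convect \<Omega> v u x \<bullet> \<psi> x) + b * (convect \<Omega> v w x \<bullet> \<psi> x) \<partial>lebesgue_on \<Omega>)"
    unfolding L2_inner_def
  proof (rule integral_cong_AE)
    show "(\<lambda>x. convect \<Omega> v (\<lambda>x. a *\<^sub>R u x + b *\<^sub>R w x) x \<bullet> \<psi> x) \<in> borel_measurable (lebesgue_on \<Omega>)"
      by (rule borel_measurable_integrable[OF i(3)])
    show "(\<lambda>x. a * (convect \<Omega> v u x \<bullet> \<psi> x) + b * (convect \<Omega> v w x \<bullet> \<psi> x)) \<in> borel_measurable (lebesgue_on \<Omega>)"
      by (intro borel_measurable_integrable Bochner_Integration.integrable_add integrable_mult_right i)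
    show "AE x in lebesgue_on \<Omega>. convect \<Omega> v (\<lambda>x. a *\<^sub>R u x + b *\<^sub>R w x) x \<bullet> \<psi> x
        = a * (convect \<Omega> v u x \<bullet> \<psi> x) + b * (convect \<Omega> v w x \<bullet> \<psi> x)"
      using grad_lincomb[OF assms(1,4,5), of a b] unfolding ae_eq_def
      by eventually_elim
         (simp add: convect_def matrix_vector_mult_add_rdistrib scaleR_matrix_vector_assoc[symmetric]
           inner_add_left)
  qed
  also have "\<dots> = a * L2_inner \<Omega> (convect \<Omega> v u) \<psi> + b * L2_inner \<Omega> (convect \<Omega> v w) \<psi>"
    using i by (simp add: L2_inner_def)
  finally show ?thesis .
qed

lemma grad_norm_minus_le:
  assumes "open \<Omega>" "u \<in> X_space \<Omega>"
  shows "grad_norm \<Omega> (\<lambda>x. - u x) \<le> grad_norm \<Omega> u"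
  using grad_norm_lincomb_le[OF assms(1) assms(2) assms(2), of "-1" 0] by simp

lemma grad_norm_minus:
  assumes "open \<Omega>" "u \<in> X_space \<Omega>"
  shows "grad_norm \<Omega> (\<lambda>x. - u x) = grad_norm \<Omega> u"
proof (rule antisym)
  show "grad_norm \<Omega> (\<lambda>x. - u x) \<le> grad_norm \<Omega> u" by (rule grad_norm_minus_le[OF assms])
  have "(\<lambda>x. - u x) \<in> X_space \<Omega>" using X_space_lincomb[OF assms(1,2,2), of "-1" 0] by simp
  from grad_norm_minus_le[OF assms(1) this] show "grad_norm \<Omega> u \<le> grad_norm \<Omega> (\<lambda>x. - u x)" by simp
qed

text \<open>
  The bound on the absolute value follows by inserting both \<open>\<psi>\<close> and \<open>- \<psi>\<close>.
\<close>

lemma convection_bound: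
  assumes "open \<Omega>" "convection_constant \<Omega> M" "v \<in> X_space \<Omega>" "w \<in> X_space \<Omega>" "\<psi> \<in> X_space \<Omega>"
  shows "\<bar>L2_inner \<Omega> (convect \<Omega> v w) \<psi>\<bar> \<le> M * grad_norm \<Omega> v * grad_norm \<Omega> w * grad_norm \<Omega> \<psi>"
proof -
  have m: "(\<lambda>x. - \<psi> x) \<in> X_space \<Omega>" using X_space_lincomb[OF assms(1,5,5), of "-1" 0] by simp
  have "L2_inner \<Omega> (convect \<Omega> v w) (\<lambda>x. - \<psi> x) = - L2_inner \<Omega> (convect \<Omega> v w) \<psi>"
    by (simp add: L2_inner_def)
  moreover have "L2_inner \<Omega> (convect \<Omega> v w) \<theta> \<le> M * grad_norm \<Omega> v * grad_norm \<Omega> w * grad_norm \<Omega> \<theta>"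
    if "\<theta> \<in> X_space \<Omega>" for \<theta>
    using assms(2-4) that unfolding convection_constant_def by blast
  from this[OF assms(5)] this[OF m] have
    "L2_inner \<Omega> (convect \<Omega> v w) \<psi> \<le> M * grad_norm \<Omega> v * grad_norm \<Omega> w * grad_norm \<Omega> \<psi>"
    "L2_inner \<Omega> (convect \<Omega> v w) (\<lambda>x. - \<psi> x) \<le> M * grad_norm \<Omega> v * grad_norm \<Omega> w * grad_norm \<Omega> \<psi>"
    by (simp_all add: grad_norm_minus[OF assms(1,5)])
  ultimately show ?thesis by simp
qed

definition test_fields :: "(real^'d) set \<Rightarrow> (real^'d \<Rightarrow> real^'d) set" where
  "test_fields \<Omega> = {\<phi>. \<forall>i. (\<lambda>x. \<phi> x $ i) \<in> test_functions \<Omega>}"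

lemma test_fields_X_space: "open \<Omega> \<Longrightarrow> \<phi> \<in> test_fields \<Omega> \<Longrightarrow> \<phi> \<in> X_space \<Omega>"
  by (simp add: test_fields_def X_space_def test_functions_H10)

lemma grad_test_field:
  assumes "open \<Omega>" "\<phi> \<in> test_fields \<Omega>"
  shows "ae_eq \<Omega> (grad \<Omega> \<phi>) (\<lambda>x. \<chi> i. classical_grad (\<lambda>y. \<phi> y $ i) x)"
proof -
  have "ae_eq \<Omega> (weak_grad \<Omega> (\<lambda>y. \<phi> y $ i)) (classical_grad (\<lambda>y. \<phi> y $ i))" for i
    using assms weak_grad_ae_eq[OF assms(1) has_weak_grad_classical_grad[OF assms(1)]]
    by (simp add: test_fields_def)
  then have "AE x in lebesgue_on \<Omega>. \<forall>i\<in>UNIV. weak_grad \<Omega> (\<lambda>y. \<phi> y $ i) x = classical_grad (\<lambda>y. \<phi> y $ i) x"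
    by (intro AE_finite_allI) (auto simp: ae_eq_def)
  then show ?thesis unfolding ae_eq_def
    by eventually_elim (simp add: grad_def)
qed

text \<open>
  The Frobenius norm of a matrix field is the Euclidean norm of the norms of its rows; the \<open>\<ell>\<^sup>1\<close> norm is
  a convenient upper bound.
\<close>

lemma L2_norm_vec_le_sum:
  fixes U :: "real^'d \<Rightarrow> 'b::euclidean_space^'n"
  assumes "U \<in> L2 \<Omega>"
  shows "L2_norm \<Omega> U \<le> (\<Sum>i\<in>UNIV. L2_norm \<Omega> (\<lambda>x. U x $ i))"
proof -
  have "L2_inner \<Omega> U U = (\<Sum>i\<in>UNIV. L2_inner \<Omega> (\<lambda>x. U x $ i) (\<lambda>x. U x $ i))"
    unfolding L2_inner_def inner_vec_def
    by (intro Bochner_Integration.integral_sum L2_inner_integrable L2_vec_nth assms)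
  also have "\<dots> = (\<Sum>i\<in>UNIV. (L2_norm \<Omega> (\<lambda>x. U x $ i))\<^sup>2)"
    by (simp only: L2_norm_power2)
  finally have "L2_norm \<Omega> U = L2_set (\<lambda>i. L2_norm \<Omega> (\<lambda>x. U x $ i)) UNIV"
    by (simp add: L2_norm_def L2_set_def)
  then show ?thesis by (simp add: L2_set_le_sum L2_norm_nonneg)
qed

text \<open>
  Each row of the gradient is approximated to within \<open>\<epsilon> / d\<close> in \<open>d\<close> dimensions.
\<close>

lemma test_fields_dense:
  assumes "open \<Omega>" "w \<in> X_space \<Omega>" "0 < \<epsilon>"
  obtains \<phi> where "\<phi> \<in> test_fields \<Omega>" "grad_norm \<Omega> (\<lambda>x. w x - \<phi> x) < \<epsilon>"
proof -
  let ?n = "real CARD('a)"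
  have n: "0 < ?n" by simp
  then have \<delta>: "0 < \<epsilon> / ?n" using assms(3) by simp
  have "\<forall>i. \<exists>\<phi>. \<phi> \<in> test_functions \<Omega> \<and>
      L2_norm \<Omega> (\<lambda>x. weak_grad \<Omega> (\<lambda>y. w y $ i) x - classical_grad \<phi> x) < \<epsilon> / ?n"
    using X_space_component[OF assms(2)] \<delta> unfolding H10_iff by blast
  then obtain \<Phi> where \<Phi>: "\<And>i. \<Phi> i \<in> test_functions \<Omega>"
    "\<And>i. L2_norm \<Omega> (\<lambda>x. weak_grad \<Omega> (\<lambda>y. w y $ i) x - classical_grad (\<Phi> i) x) < \<epsilon> / ?n"
    by metis
  define \<phi> where "\<phi> x = (\<chi> i. \<Phi> i x)" for x
  have t: "\<phi> \<in> test_fields \<Omega>" using \<Phi>(1) by (simp add: test_fields_def \<phi>_def)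
  note X = test_fields_X_space[OF assms(1) t]
  let ?d = "\<lambda>x. w x - \<phi> x"
  have dX: "?d \<in> X_space \<Omega>" using X_space_lincomb[OF assms(1,2) X, of 1 "-1"] by simp
  let ?D = "\<lambda>x. \<chi> i. weak_grad \<Omega> (\<lambda>y. w y $ i) x - classical_grad (\<Phi> i) x"
  have D2: "?D \<in> L2 \<Omega>"
    by (intro L2_vec_lambda L2_diff weak_grad_L2 H10_imp_H1 X_space_component assms(2)
        classical_grad_L2 assms(1) \<Phi>(1))
  have "ae_eq \<Omega> (grad \<Omega> ?d) ?D"
    using grad_lincomb[OF assms(1,2) X, of 1 "-1"] grad_test_field[OF assms(1) t]
    unfolding ae_eq_def
    by eventually_elim (simp add: vec_eq_iff grad_def \<phi>_def)
  then have "grad_norm \<Omega> ?d = L2_norm \<Omega> ?D"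
    by (intro L2_norm_cong L2_measurable grad_L2 dX D2)
  also have "\<dots> \<le> (\<Sum>i\<in>UNIV. L2_norm \<Omega> (\<lambda>x. ?D x $ i))" by (rule L2_norm_vec_le_sum[OF D2])
  also have "\<dots> < (\<Sum>i\<in>(UNIV::'a set). \<epsilon> / ?n)"
    using \<Phi>(2) by (intro sum_strict_mono) auto
  also have "\<dots> = \<epsilon>" using n by simp
  finally show ?thesis using that t by blast
qed

text \<open>
  Pointwise \<open>(v \<cdot> \<nabla>\<phi>) \<cdot> \<phi>\<close> is half of \<open>v \<cdot> \<nabla>\<close> applied to the sum of the squares \<open>\<phi>\<^sub>i\<^sup>2\<close>. These squares are
  test functions, so the definition of the weak gradient of \<open>v\<close> moves the derivative onto \<open>v\<close>, where it
  becomes the divergence.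
\<close>

lemma convection_test_field_eq_0:
  assumes "open \<Omega>" "bounded \<Omega>" "\<Omega> \<noteq> {}" "convection_constant \<Omega> M"
    and v: "v \<in> V_space \<Omega>" and \<phi>: "\<phi> \<in> test_fields \<Omega>"
  shows "L2_inner \<Omega> (convect \<Omega> v \<phi>) \<phi> = 0"
proof -
  note X = V_space_imp_X_space[OF v] and \<phi>X = test_fields_X_space[OF assms(1) \<phi>]
  have t: "(\<lambda>x. \<phi> x $ i) \<in> test_functions \<Omega>" for i using \<phi> by (simp add: test_fields_def)
  let ?s = "\<lambda>i x. \<phi> x $ i * \<phi> x $ i"
  have s: "?s i \<in> test_functions \<Omega>" for i
    by (rule test_functions_smooth_mult[OF t test_functions_C_k[OF t]])
  have ds: "classical_grad (?s i) x $ j = 2 * (\<phi> x $ i * classical_grad (\<lambda>y. \<phi> y $ i) x $ j)" for i j x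
    using classical_grad_mult[OF test_functions_differentiable[OF t] test_functions_differentiable[OF t], of i i x j]
    by simp
  have int: "integrable (lebesgue_on \<Omega>) (\<lambda>x. v x $ j \<bullet> classical_grad (?s i) x $ j)" for i j
    by (intro L2_inner_integrable test_functions_L2 assms(1) test_functions_grad s H10_imp_L2
        X_space_component X)
  have "L2_inner \<Omega> (convect \<Omega> v \<phi>) \<phi>
      = (\<integral>x. (\<Sum>i\<in>UNIV. \<Sum>j\<in>UNIV. (1/2) * (v x $ j \<bullet> classical_grad (?s i) x $ j)) \<partial>lebesgue_on \<Omega>)"
    unfolding L2_inner_def
  proof (rule integral_cong_AE)
    show "(\<lambda>x. convect \<Omega> v \<phi> x \<bullet> \<phi> x) \<in> borel_measurable (lebesgue_on \<Omega>)"
      by (rule borel_measurable_integrable[OF convection_integrable[OF assms(4) X \<phi>X \<phi>X]])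
    show "(\<lambda>x. \<Sum>i\<in>UNIV. \<Sum>j\<in>UNIV. (1/2) * (v x $ j \<bullet> classical_grad (?s i) x $ j)) \<in> borel_measurable (lebesgue_on \<Omega>)"
      by (intro borel_measurable_integrable Bochner_Integration.integrable_sum integrable_mult_right int)
    show "AE x in lebesgue_on \<Omega>. convect \<Omega> v \<phi> x \<bullet> \<phi> x
        = (\<Sum>i\<in>UNIV. \<Sum>j\<in>UNIV. (1/2) * (v x $ j \<bullet> classical_grad (?s i) x $ j))"
      using grad_test_field[OF assms(1) \<phi>] unfolding ae_eq_def
      by eventually_elim
         (simp add: convect_def inner_vec_def matrix_vector_mult_def ds sum_distrib_left
           mult.commute mult.left_commute)
  qed
  also have "\<dots> = (\<Sum>i\<in>UNIV. \<Sum>j\<in>UNIV. (1/2) * L2_inner \<Omega> (\<lambda>x. v x $ j) (\<lambda>x. classical_grad (?s i) x $ j))"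
    using int by (simp add: L2_inner_def Bochner_Integration.integral_sum)
  also have "\<dots> = (\<Sum>i\<in>UNIV. (1/2) * - L2_inner \<Omega> (divergence \<Omega> v) (?s i))"
  proof (rule sum.cong[OF refl])
    fix i
    have "L2_inner \<Omega> (\<lambda>x. v x $ j) (\<lambda>x. classical_grad (?s i) x $ j)
        = - L2_inner \<Omega> (\<lambda>x. grad \<Omega> v x $ j $ j) (?s i)" for j
      using has_weak_grad_weak_grad[OF H10_imp_H1[OF X_space_component[OF X, of j]]] s[of i]
      unfolding has_weak_grad_def by (simp add: grad_def)
    moreover have "L2_inner \<Omega> (divergence \<Omega> v) (?s i) = (\<Sum>j\<in>UNIV. L2_inner \<Omega> (\<lambda>x. grad \<Omega> v x $ j $ j) (?s i))"
      unfolding divergence_def[abs_def]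
      by (intro L2_inner_sum_left L2_vec_nth grad_L2 X test_functions_L2 assms(1) s)
    ultimately show "(\<Sum>j\<in>UNIV. (1/2) * L2_inner \<Omega> (\<lambda>x. v x $ j) (\<lambda>x. classical_grad (?s i) x $ j))
        = (1/2) * - L2_inner \<Omega> (divergence \<Omega> v) (?s i)"
      by (simp add: sum_distrib_left sum_negf)
  qed
  also have "\<dots> = 0"
    using V_space_divergence_orthogonal[OF assms(1-3) v test_functions_L2[OF assms(1) s]] by simp
  finally show ?thesis .
qed

text \<open>
  With \<open>d = w - \<phi>\<close> for a test field \<open>\<phi>\<close>, one has
  \<open>b(v, w, w) = b(v, d, w) + b(v, \<phi>, d) + b(v, \<phi>, \<phi>)\<close>. The last term is zero and the first two are
  small with \<open>\<parallel>\<nabla>d\<parallel>\<close>.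
\<close>

lemma convection_skew:
  assumes "open \<Omega>" "bounded \<Omega>" "\<Omega> \<noteq> {}" "convection_constant \<Omega> M"
    and v: "v \<in> V_space \<Omega>" and w: "w \<in> X_space \<Omega>"
  shows "L2_inner \<Omega> (convect \<Omega> v w) w = 0"
proof (rule ccontr)
  let ?b = "\<lambda>w \<psi>. L2_inner \<Omega> (convect \<Omega> v w) \<psi>"
  assume "?b w w \<noteq> 0"
  note X = V_space_imp_X_space[OF v]
  define c where "c = \<bar>?b w w\<bar>"
  define K where "K = \<bar>M * grad_norm \<Omega> v\<bar>"
  define W where "W = grad_norm \<Omega> w"
  \<comment> \<open>chosen so that \<open>\<epsilon> K (2 W + \<epsilon>) < c\<close>, the bound that the three-term splitting yields\<close>
  define \<epsilon> where "\<epsilon> = min 1 (c / (2 * (K * (2 * W + 1) + 1)))"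
  have c: "0 < c" using \<open>?b w w \<noteq> 0\<close> by (simp add: c_def)
  have KW: "0 \<le> K" "0 \<le> W" by (auto simp: K_def W_def L2_norm_nonneg)
  have den: "0 < 2 * (K * (2 * W + 1) + 1)" using KW by (simp add: add_nonneg_pos)
  have \<epsilon>: "0 < \<epsilon>" "\<epsilon> \<le> 1" "\<epsilon> \<le> c / (2 * (K * (2 * W + 1) + 1))"
    using c den by (auto simp: \<epsilon>_def)
  obtain \<phi> where \<phi>: "\<phi> \<in> test_fields \<Omega>" "grad_norm \<Omega> (\<lambda>x. w x - \<phi> x) < \<epsilon>"
    using test_fields_dense[OF assms(1) w \<epsilon>(1)] by metis
  note \<phi>X = test_fields_X_space[OF assms(1) \<phi>(1)]
  let ?d = "\<lambda>x. w x - \<phi> x"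
  have dX: "?d \<in> X_space \<Omega>" using X_space_lincomb[OF assms(1) w \<phi>X, of 1 "-1"] by simp
  have \<phi>W: "grad_norm \<Omega> \<phi> \<le> W + \<epsilon>"
    using grad_norm_lincomb_le[OF assms(1) w dX, of 1 "-1"] \<phi>(2) by (simp add: W_def)
  have "?b ?d w = ?b w w - ?b \<phi> w"
    using convection_lincomb_advected[OF assms(1,4) X w \<phi>X w, of 1 "-1"] by simp
  moreover have "?b \<phi> ?d = ?b \<phi> w - ?b \<phi> \<phi>"
    using convection_lincomb_test[OF assms(4) X \<phi>X w \<phi>X, of 1 "-1"] by simp
  ultimately have "?b w w = ?b ?d w + ?b \<phi> ?d"
    using convection_test_field_eq_0[OF assms(1-4) v \<phi>(1)] by simp
  then have "c \<le> \<bar>?b ?d w\<bar> + \<bar>?b \<phi> ?d\<bar>" by (simp add: c_def)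
  also have "\<bar>?b ?d w\<bar> \<le> K * (\<epsilon> * W)"
  proof -
    have "\<bar>?b ?d w\<bar> \<le> (M * grad_norm \<Omega> v) * (grad_norm \<Omega> ?d * W)"
      using convection_bound[OF assms(1,4) X dX w] by (simp add: W_def mult.assoc)
    also have "\<dots> \<le> K * (\<epsilon> * W)"
      unfolding K_def using \<phi>(2) \<epsilon>(1) KW by (intro mult_mono) (auto simp: L2_norm_nonneg)
    finally show ?thesis .
  qed
  also have "\<bar>?b \<phi> ?d\<bar> \<le> K * ((W + \<epsilon>) * \<epsilon>)"
  proof -
    have "\<bar>?b \<phi> ?d\<bar> \<le> (M * grad_norm \<Omega> v) * (grad_norm \<Omega> \<phi> * grad_norm \<Omega> ?d)"
      using convection_bound[OF assms(1,4) X \<phi>X dX] by (simp add: mult.assoc)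
    also have "\<dots> \<le> K * ((W + \<epsilon>) * \<epsilon>)"
      unfolding K_def using \<phi>(2) \<phi>W \<epsilon>(1) KW by (intro mult_mono) (auto simp: L2_norm_nonneg)
    finally show ?thesis .
  qed
  also have "K * (\<epsilon> * W) + K * ((W + \<epsilon>) * \<epsilon>) = \<epsilon> * (K * (2 * W + \<epsilon>))" by (simp add: algebra_simps)
  also have "\<dots> \<le> \<epsilon> * (K * (2 * W + 1) + 1)"
  proof (rule mult_left_mono)
    have "K * (2 * W + \<epsilon>) \<le> K * (2 * W + 1)" using \<epsilon>(2) KW(1) by (intro mult_left_mono) auto
    then show "K * (2 * W + \<epsilon>) \<le> K * (2 * W + 1) + 1" by simp
  qed (use \<epsilon>(1) in simp)
  also have "\<dots> \<le> c / 2"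
    using \<epsilon>(3) den by (simp add: field_simps)
  finally show False using c by simp
qed

section \<open>A nonzero divergence-free field\<close>

lemma continuous_nonzero_not_ae_eq_0:
  fixes u :: "real^'d \<Rightarrow> 'b::euclidean_space"
  assumes "open \<Omega>" "continuous_on UNIV u" "c \<in> \<Omega>" "u c \<noteq> 0"
  shows "\<not> ae_eq \<Omega> u (\<lambda>x. 0)"
proof
  assume ae: "ae_eq \<Omega> u (\<lambda>x. 0)"
  let ?S = "\<Omega> \<inter> u -` (- {0})"
  have "open ?S"
    using assms(1,2) by (intro open_Int open_vimage) auto
  moreover have "?S \<noteq> {}" using assms(3,4) by auto
  ultimately have "\<not> negligible ?S" by (rule open_not_negligible)
  have leb: "\<Omega> \<inter> space lebesgue \<in> sets lebesgue" using assms(1) by (simp add: lebesgue_openin)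
  have "AE x in lebesgue. x \<in> \<Omega> \<longrightarrow> u x = 0"
    using ae unfolding ae_eq_def AE_restrict_space_iff[OF leb] .
  then have "AE x in lebesgue. x \<notin> ?S" by eventually_elim auto
  moreover have "?S \<in> sets lebesgue" using \<open>open ?S\<close> by (simp add: lebesgue_openin)
  ultimately have "?S \<in> null_sets lebesgue" by (simp add: AE_iff_null_sets)
  with \<open>\<not> negligible ?S\<close> show False by (simp add: negligible_iff_null_sets)
qed

text \<open>
  In the plane of two coordinates \<open>i\<close> and \<open>j\<close>, the rotation \<open>(x\<^sub>j - c\<^sub>j, - (x\<^sub>i - c\<^sub>i))\<close> is divergence-free
  and tangent to spheres about \<open>c\<close>. Multiplying it by a radial bump \<open>\<xi>\<close> keeps it divergence-free,
  because the gradient of \<open>\<xi>\<close> is radial.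
\<close>

lemma V_space_nontrivial:
  fixes \<Omega> :: "(real^'d) set"
  assumes "open \<Omega>" "\<Omega> \<noteq> {}" "2 \<le> CARD('d)"
  obtains v where "v \<in> V_space \<Omega>" "\<not> ae_eq \<Omega> v (\<lambda>x. 0)"
proof -
  obtain i j :: 'd where ij: "i \<noteq> j"
    using assms(3) by (metis card_2_iff' card_le_Suc0_iff_eq finite UNIV_I not_less_eq_eq numeral_2_eq_2)
  obtain c where c: "c \<in> \<Omega>" using assms(2) by blast
  obtain r where r: "0 < r" "cball c r \<subseteq> \<Omega>" using assms(1) c open_contains_cball by blast
  define p where "p x = r\<^sup>2 - (x - c) \<bullet> (x - c)" for x
  define \<xi> where "\<xi> x = flat_exp 0 (p x)" for x
  have pC: "C_k k p" for k
  proof -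
    have "C_k k (\<lambda>x. r\<^sup>2 + (-1) * (\<Sum>l\<in>UNIV. (x $ l + (- c $ l)) * (x $ l + (- c $ l))))"
      by (intro C_k_add C_k_mult C_k_const C_k_sum C_k_coordinate)
    moreover have "p = (\<lambda>x. r\<^sup>2 + (-1) * (\<Sum>l\<in>UNIV. (x $ l + (- c $ l)) * (x $ l + (- c $ l))))"
      by (simp add: p_def fun_eq_iff inner_vec_def)
    ultimately show ?thesis by simp
  qed
  have pd: "p differentiable at x" for x using pC[of 1] by simp
  have dp: "classical_grad p x $ l = - 2 * (x $ l - c $ l)" for x l
  proof -
    have "(p has_derivative (\<lambda>h. - ((x - c) \<bullet> h + h \<bullet> (x - c)))) (at x)"
      unfolding p_def by (auto intro!: derivative_eq_intros)
    from classical_grad_eqI[OF this] show ?thesis by (simp add: inner_axis inner_axis')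
  qed
  define e where "e = flat_exp (0 + 2)"
  have d\<xi>: "classical_grad \<xi> x $ l = e (p x) * (- 2 * (x $ l - c $ l))" for x l
    using classical_grad_compose[OF flat_exp_has_derivative[of 0 "p x"] pd, of l]
    by (simp add: \<xi>_def[abs_def] dp e_def del: add_0)
  have \<xi>: "\<xi> \<in> test_functions \<Omega>"
  proof (rule test_functionsI)
    show "C_k k \<xi>" for k unfolding \<xi>_def[abs_def] by (intro C_k_flat_exp pC)
    show "compact (cball c r)" "cball c r \<subseteq> \<Omega>" using r by auto
    show "\<xi> x = 0" if "x \<notin> cball c r" for x
    proof -
      have "r < norm (x - c)" using that by (simp add: dist_norm norm_minus_commute)
      then have "r\<^sup>2 \<le> (norm (x - c))\<^sup>2" using r(1) by (intro power_mono) auto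
      then show ?thesis by (simp add: \<xi>_def p_def flat_exp_def power2_norm_eq_inner)
    qed
  qed
  \<comment> \<open>the rotation: component \<open>k\<close> is \<open>a k (x - c)\<close> taken in the coordinate \<open>b k\<close>\<close>
  define a where "a k = (if k = i then 1 else if k = j then -1 else 0 :: real)" for k
  define b where "b k = (if k = i then j else i)" for k
  define v where "v x = (\<chi> k. (a k * (x $ b k - c $ b k)) * \<xi> x)" for x
  have lC: "C_k l (\<lambda>x. a k * (x $ b k - c $ b k))" for k l
  proof -
    have "C_k l (\<lambda>x. a k * (x $ b k + (- c $ b k)))"
      by (intro C_k_add C_k_mult C_k_const C_k_coordinate)
    then show ?thesis by simp
  qed
  have v: "v \<in> test_fields \<Omega>"
    using test_functions_smooth_mult[OF \<xi> lC] by (simp add: test_fields_def v_def)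
  note X = test_fields_X_space[OF assms(1) v]
  have dv: "classical_grad (\<lambda>x. v x $ k) x $ k = - 2 * (a k * (x $ b k - c $ b k)) * (e (p x) * (x $ k - c $ k))" for x k
  proof -
    have "b k = k \<Longrightarrow> a k = 0" using ij by (auto simp: a_def b_def split: if_splits)
    have "((\<lambda>x. a k * (x $ b k - c $ b k)) has_derivative (\<lambda>h. a k * (h $ b k))) (at x)"
      by (auto intro!: derivative_eq_intros bounded_linear_imp_has_derivative bounded_linear_vec_nth)
    from classical_grad_eqI[OF this, of k]
    have z: "classical_grad (\<lambda>x. a k * (x $ b k - c $ b k)) x $ k = 0"
      using \<open>b k = k \<Longrightarrow> a k = 0\<close> by (auto simp: axis_def)
    have "(\<lambda>x. a k * (x $ b k - c $ b k)) differentiable at x"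
      using lC[of "Suc 0" k] unfolding C_k.simps by blast
    from classical_grad_mult[OF this test_functions_differentiable[OF \<xi>], of k] z
    have "classical_grad (\<lambda>x. v x $ k) x $ k
        = a k * (x $ b k - c $ b k) * (e (p x) * (- 2 * (x $ k - c $ k)))"
      by (simp add: v_def d\<xi>)
    then show ?thesis by (simp only: mult_ac)
  qed
  have div0: "(\<Sum>k\<in>UNIV. classical_grad (\<lambda>x. v x $ k) x $ k) = 0" for x
  proof -
    have "(\<Sum>k\<in>UNIV. classical_grad (\<lambda>x. v x $ k) x $ k) = (\<Sum>k\<in>{i, j}. classical_grad (\<lambda>x. v x $ k) x $ k)"
      by (rule sum.mono_neutral_right) (auto simp: dv a_def)
    also have "\<dots> = 0" using ij by (simp add: dv a_def b_def algebra_simps)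
    finally show ?thesis .
  qed
  have "ae_eq \<Omega> (divergence \<Omega> v) (\<lambda>x. 0)"
    using grad_test_field[OF assms(1) v] unfolding ae_eq_def
    by eventually_elim (simp add: divergence_def div0)
  then have "L2_inner \<Omega> (divergence \<Omega> v) q = 0" for q
    unfolding L2_inner_def ae_eq_def by (intro integral_eq_zero_AE) (auto elim: eventually_mono)
  with X have V: "v \<in> V_space \<Omega>" by (simp add: V_space_def)
  \<comment> \<open>a point of the ball at which the component \<open>i\<close> of the field does not vanish\<close>
  define y where "y = c + (r / 2) *\<^sub>R axis j 1"
  have yj: "y $ j - c $ j = r / 2" by (simp add: y_def axis_def)
  have "p y = 3 / 4 * r\<^sup>2" by (simp add: p_def y_def inner_axis_axis power2_eq_square)
  moreover have "0 < 3 / 4 * r\<^sup>2" using r(1) by simp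
  ultimately have "0 < p y" by (simp only:)
  then have "0 < \<xi> y" by (simp add: \<xi>_def flat_exp_pos_iff)
  then have "v y $ i \<noteq> 0" using r(1) yj by (simp add: v_def a_def b_def)
  then have "v y \<noteq> 0" by auto
  moreover have "y \<in> \<Omega>"
  proof -
    have "dist c y \<le> r" using r(1) by (simp add: y_def dist_norm norm_axis_1)
    with r(2) show ?thesis by auto
  qed
  moreover have "continuous_on UNIV v"
  proof -
    have "continuous_on UNIV (\<lambda>x. v x $ k)" for k
      using v test_functions_continuous by (auto simp: test_fields_def)
    then have "continuous_on UNIV (\<lambda>x. \<chi> k. v x $ k)" by (rule continuous_on_vec_lambda)
    then show ?thesis by simp
  qed
  ultimately have "\<not> ae_eq \<Omega> v (\<lambda>x. 0)" using continuous_nonzero_not_ae_eq_0[OF assms(1)] by blast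
  with V show ?thesis by (rule that)
qed

section \<open>Dual norms and the estimates\<close>

text \<open>
  A field that vanishes almost everywhere has the weak gradient zero. Such fields are excluded from the
  supremum in the dual norm, and this lemma covers them when the dual norm is used to bound a functional.
\<close>

lemma grad_norm_eq_0:
  assumes "open \<Omega>" "\<psi> \<in> X_space \<Omega>" "ae_eq \<Omega> \<psi> (\<lambda>x. 0)"
  shows "grad_norm \<Omega> \<psi> = 0"
proof (rule L2_norm_eq_0)
  have "has_weak_grad \<Omega> (\<lambda>x. \<psi> x $ i) (\<lambda>x. 0)" for i
  proof -
    have "L2_inner \<Omega> (\<lambda>x. \<psi> x $ i) u = 0" for u
      unfolding L2_inner_def using assms(3) unfolding ae_eq_def
      by (intro integral_eq_zero_AE) (auto elim: eventually_mono)
    then show ?thesis by (simp add: has_weak_grad_def L2_def L2_inner_def)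
  qed
  then have "AE x in lebesgue_on \<Omega>. \<forall>i\<in>UNIV. weak_grad \<Omega> (\<lambda>y. \<psi> y $ i) x = 0"
    using weak_grad_ae_eq[OF assms(1)] by (intro AE_finite_allI) (auto simp: ae_eq_def)
  then show "ae_eq \<Omega> (grad \<Omega> \<psi>) (\<lambda>x. 0)"
    unfolding ae_eq_def by eventually_elim (simp add: grad_def vec_eq_iff)
qed

text \<open>
  The properties of a functional that make its dual norm a genuine supremum and a bound for its absolute
  value: the set of quotients is nonempty and bounded above, and is symmetric about zero.
\<close>

definition bounded_odd_on where
  "bounded_odd_on \<Omega> W F \<longleftrightarrow> W \<subseteq> X_space \<Omega> \<and> (\<exists>\<psi>\<in>W. \<not> ae_eq \<Omega> \<psi> (\<lambda>x. 0)) \<and>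
     (\<forall>\<psi>\<in>W. (\<lambda>x. - \<psi> x) \<in> W \<and> F (\<lambda>x. - \<psi> x) = - F \<psi>) \<and>
     (\<exists>C. \<forall>\<psi>\<in>W. \<bar>F \<psi>\<bar> \<le> C * grad_norm \<Omega> \<psi>)"

lemma bounded_odd_quotient_le_dual_norm:
  assumes "bounded_odd_on \<Omega> W F" "\<psi> \<in> W" "\<not> ae_eq \<Omega> \<psi> (\<lambda>x. 0)"
  shows "F \<psi> / grad_norm \<Omega> \<psi> \<le> dual_norm \<Omega> W F"
  unfolding dual_norm_def
proof (rule cSup_upper)
  obtain C where C: "\<And>\<psi>. \<psi> \<in> W \<Longrightarrow> \<bar>F \<psi>\<bar> \<le> C * grad_norm \<Omega> \<psi>"
    using assms(1) unfolding bounded_odd_on_def by blast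
  show "bdd_above {F \<psi> / grad_norm \<Omega> \<psi> |\<psi>. \<psi> \<in> W \<and> \<not> ae_eq \<Omega> \<psi> (\<lambda>x. 0)}"
  proof (rule bdd_aboveI[of _ "\<bar>C\<bar>"], clarify)
    fix \<psi> assume "\<psi> \<in> W"
    have "F \<psi> \<le> C * grad_norm \<Omega> \<psi>" using C[OF \<open>\<psi> \<in> W\<close>] by simp
    also have "\<dots> \<le> \<bar>C\<bar> * grad_norm \<Omega> \<psi>" by (intro mult_right_mono) (auto simp: L2_norm_nonneg)
    finally show "F \<psi> / grad_norm \<Omega> \<psi> \<le> \<bar>C\<bar>"
      using L2_norm_nonneg[of \<Omega> "grad \<Omega> \<psi>"]
      by (cases "grad_norm \<Omega> \<psi> = 0") (auto simp: divide_le_eq)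
  qed
qed (use assms(2,3) in blast)

lemma bounded_odd_abs_quotient_le_dual_norm:
  assumes "open \<Omega>" "bounded_odd_on \<Omega> W F" "\<psi> \<in> W" "\<not> ae_eq \<Omega> \<psi> (\<lambda>x. 0)"
  shows "\<bar>F \<psi>\<bar> / grad_norm \<Omega> \<psi> \<le> dual_norm \<Omega> W F"
proof -
  have m: "(\<lambda>x. - \<psi> x) \<in> W" "F (\<lambda>x. - \<psi> x) = - F \<psi>" and X: "\<psi> \<in> X_space \<Omega>"
    using assms(2,3) unfolding bounded_odd_on_def by blast+
  have "\<not> ae_eq \<Omega> (\<lambda>x. - \<psi> x) (\<lambda>x. 0)" using assms(4) by (simp add: ae_eq_def)
  from bounded_odd_quotient_le_dual_norm[OF assms(2) m(1) this]
    bounded_odd_quotient_le_dual_norm[OF assms(2-4)]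
  show ?thesis
    by (simp add: m(2) grad_norm_minus[OF assms(1) X] abs_if)
qed

lemma dual_norm_nonneg:
  assumes "open \<Omega>" "bounded_odd_on \<Omega> W F"
  shows "0 \<le> dual_norm \<Omega> W F"
proof -
  obtain \<psi> where "\<psi> \<in> W" "\<not> ae_eq \<Omega> \<psi> (\<lambda>x. 0)" using assms(2) unfolding bounded_odd_on_def by blast
  from bounded_odd_abs_quotient_le_dual_norm[OF assms this]
  show ?thesis by (rule order_trans[rotated]) (simp add: L2_norm_nonneg)
qed

text \<open>
  If \<open>\<parallel>\<nabla>\<psi>\<parallel> = 0\<close>, then boundedness gives \<open>F \<psi> = 0\<close>; otherwise \<open>\<psi>\<close> takes part in the supremum.
\<close>

lemma abs_le_dual_norm:
  assumes "open \<Omega>" "bounded_odd_on \<Omega> W F" "\<psi> \<in> W"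
  shows "\<bar>F \<psi>\<bar> \<le> dual_norm \<Omega> W F * grad_norm \<Omega> \<psi>"
proof (cases "grad_norm \<Omega> \<psi> = 0")
  case True
  obtain C where "\<bar>F \<psi>\<bar> \<le> C * grad_norm \<Omega> \<psi>"
    using assms(2,3) unfolding bounded_odd_on_def by blast
  with True show ?thesis by simp
next
  case False
  have "\<psi> \<in> X_space \<Omega>" using assms(2,3) unfolding bounded_odd_on_def by blast
  with False have "\<not> ae_eq \<Omega> \<psi> (\<lambda>x. 0)" using grad_norm_eq_0[OF assms(1)] by blast
  from bounded_odd_abs_quotient_le_dual_norm[OF assms this] show ?thesis
    using False L2_norm_nonneg[of \<Omega> "grad \<Omega> \<psi>"] by (simp add: divide_le_eq)
qed

text \<open>
  Quotients with \<open>\<parallel>\<nabla>\<psi>\<parallel> = 0\<close> are zero by the convention for division, so the bound \<open>B\<close> has to be nonnegative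
  to cover them.
\<close>

lemma dual_norm_le:
  assumes "bounded_odd_on \<Omega> W F" "0 \<le> B" "\<And>\<psi>. \<psi> \<in> W \<Longrightarrow> F \<psi> \<le> B * grad_norm \<Omega> \<psi>"
  shows "dual_norm \<Omega> W F \<le> B"
  unfolding dual_norm_def
proof (rule cSup_least)
  show "{F \<psi> / grad_norm \<Omega> \<psi> |\<psi>. \<psi> \<in> W \<and> \<not> ae_eq \<Omega> \<psi> (\<lambda>x. 0)} \<noteq> {}"
    using assms(1) unfolding bounded_odd_on_def by blast
  fix s assume "s \<in> {F \<psi> / grad_norm \<Omega> \<psi> |\<psi>. \<psi> \<in> W \<and> \<not> ae_eq \<Omega> \<psi> (\<lambda>x. 0)}"
  then obtain \<psi> where "\<psi> \<in> W" "s = F \<psi> / grad_norm \<Omega> \<psi>" by blast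
  with assms(2) assms(3)[of \<psi>] L2_norm_nonneg[of \<Omega> "grad \<Omega> \<psi>"] show "s \<le> B"
    by (cases "grad_norm \<Omega> \<psi> = 0") (auto simp: divide_le_eq)
qed

lemma X_space_uminus: "open \<Omega> \<Longrightarrow> u \<in> X_space \<Omega> \<Longrightarrow> (\<lambda>x. - u x) \<in> X_space \<Omega>"
  using X_space_lincomb[of \<Omega> u u "-1" 0] by simp

lemma V_space_uminus: "open \<Omega> \<Longrightarrow> u \<in> V_space \<Omega> \<Longrightarrow> (\<lambda>x. - u x) \<in> V_space \<Omega>"
  using V_space_lincomb[of \<Omega> u u "-1" 0] by simp

lemma H_minus1_uminus: "f \<in> H_minus1 \<Omega> \<Longrightarrow> u \<in> X_space \<Omega> \<Longrightarrow> f (\<lambda>x. - u x) = - f u"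
proof -
  assume "f \<in> H_minus1 \<Omega>" "u \<in> X_space \<Omega>"
  then have "f (\<lambda>x. (-1) *\<^sub>R u x + 0 *\<^sub>R u x) = (-1) * f u + 0 * f u"
    unfolding H_minus1_def by blast
  then show ?thesis by simp
qed

lemma bounded_odd_on_H_minus1:
  fixes \<Omega> :: "(real^'d) set"
  assumes "open \<Omega>" "\<Omega> \<noteq> {}" "2 \<le> CARD('d)" "f \<in> H_minus1 \<Omega>"
  shows "bounded_odd_on \<Omega> (X_space \<Omega>) f"
proof -
  obtain v where "v \<in> V_space \<Omega>" "\<not> ae_eq \<Omega> v (\<lambda>x. 0)" using V_space_nontrivial[OF assms(1-3)] .
  moreover have "\<exists>C. \<forall>\<psi>\<in>X_space \<Omega>. \<bar>f \<psi>\<bar> \<le> C * grad_norm \<Omega> \<psi>"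
    using assms(4) unfolding H_minus1_def by blast
  ultimately show ?thesis
    using assms(1,4) V_space_imp_X_space unfolding bounded_odd_on_def
    by (auto intro: X_space_uminus H_minus1_uminus)
qed

lemma bounded_odd_on_nonlinear_residual:
  fixes \<Omega> :: "(real^'d) set"
  assumes "open \<Omega>" "\<Omega> \<noteq> {}" "2 \<le> CARD('d)" "f \<in> H_minus1 \<Omega>"
    and "convection_constant \<Omega> M" "v \<in> X_space \<Omega>"
  shows "bounded_odd_on \<Omega> (V_space \<Omega>) (nonlinear_residual \<Omega> \<nu> f v)"
proof -
  obtain z where z: "z \<in> V_space \<Omega>" "\<not> ae_eq \<Omega> z (\<lambda>x. 0)" using V_space_nontrivial[OF assms(1-3)] .
  obtain C where C: "\<And>\<psi>. \<psi> \<in> X_space \<Omega> \<Longrightarrow> \<bar>f \<psi>\<bar> \<le> C * grad_norm \<Omega> \<psi>"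
    using assms(4) unfolding H_minus1_def by blast
  let ?G = "grad_norm \<Omega>"
  have "\<bar>nonlinear_residual \<Omega> \<nu> f v \<psi>\<bar> \<le> (\<bar>\<nu>\<bar> * ?G v + M * ?G v * ?G v + C) * ?G \<psi>"
    if "\<psi> \<in> V_space \<Omega>" for \<psi>
  proof -
    note X = V_space_imp_X_space[OF that]
    have "\<bar>\<nu> * L2_inner \<Omega> (grad \<Omega> v) (grad \<Omega> \<psi>)\<bar> \<le> \<bar>\<nu>\<bar> * (?G v * ?G \<psi>)"
      unfolding abs_mult by (intro mult_left_mono L2_Cauchy_Schwarz grad_L2 assms(6) X) simp
    with convection_bound[OF assms(1,5,6,6) X] C[OF X] show ?thesis
      unfolding nonlinear_residual_def by (simp add: algebra_simps)
  qed
  moreover have "nonlinear_residual \<Omega> \<nu> f v (\<lambda>x. - \<psi> x) = - nonlinear_residual \<Omega> \<nu> f v \<psi>"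
    if "\<psi> \<in> V_space \<Omega>" for \<psi>
  proof -
    note X = V_space_imp_X_space[OF that]
    have "L2_inner \<Omega> (grad \<Omega> v) (grad \<Omega> (\<lambda>x. - \<psi> x)) = - L2_inner \<Omega> (grad \<Omega> v) (grad \<Omega> \<psi>)"
      using grad_inner_lincomb_left[OF assms(1) X X assms(6), of "-1" 0]
      by (simp add: L2_inner_commute[of _ "grad \<Omega> v"])
    moreover have "L2_inner \<Omega> (convect \<Omega> v v) (\<lambda>x. - \<psi> x) = - L2_inner \<Omega> (convect \<Omega> v v) \<psi>"
      by (simp add: L2_inner_def)
    ultimately show ?thesis
      using H_minus1_uminus[OF assms(4) X] by (simp add: nonlinear_residual_def)
  qed
  ultimately show ?thesis
    using z V_space_imp_X_space V_space_uminus[OF assms(1)] unfolding bounded_odd_on_def by blast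
qed

theorem lemma2p1:
  fixes \<Omega> :: "(real^'d) set"
    and \<nu> M \<kappa> :: real
    and f :: "(real^'d \<Rightarrow> real^'d) \<Rightarrow> real"
    and q :: "(real^'d \<Rightarrow> real^'d) \<Rightarrow> (real^'d \<Rightarrow> real^'d)"
    and v v' w :: "real^'d \<Rightarrow> real^'d"
  assumes "CARD('d) = 2 \<or> CARD('d) = 3"
    and "open \<Omega>" and "connected \<Omega>" and "bounded \<Omega>" and "\<Omega> \<noteq> {}"
    and "\<nu> > 0"
    and "f \<in> H_minus1 \<Omega>"
    and "convection_constant \<Omega> M"
    and "\<kappa> = M * \<nu> powi (-2) * dual_norm \<Omega> (X_space \<Omega>) f"
    and "picard_operator \<Omega> \<nu> f q"
    and "v \<in> V_space \<Omega>"
    and "v' = q v"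
    and "w = (\<lambda>x. v' x - v x)"
  shows "grad_norm \<Omega> w \<le> inverse \<nu> * dual_norm \<Omega> (V_space \<Omega>) (nonlinear_residual \<Omega> \<nu> f v) \<and>
    dual_norm \<Omega> (V_space \<Omega>) (nonlinear_residual \<Omega> \<nu> f v')
      \<le> \<kappa> * dual_norm \<Omega> (V_space \<Omega>) (nonlinear_residual \<Omega> \<nu> f v)"
proof -
  have card: "2 \<le> CARD('d)" using assms(1) by auto
  let ?g = "nonlinear_residual \<Omega> \<nu> f"
  let ?b = "\<lambda>u w \<psi>. L2_inner \<Omega> (convect \<Omega> u w) \<psi>"
  let ?a = "\<lambda>u \<psi>. L2_inner \<Omega> (grad \<Omega> u) (grad \<Omega> \<psi>)"
  define F where "F = dual_norm \<Omega> (X_space \<Omega>) f"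
  define G where "G = dual_norm \<Omega> (V_space \<Omega>) (?g v)"
  have sol: "v' \<in> V_space \<Omega>" "\<And>\<psi>. \<psi> \<in> V_space \<Omega> \<Longrightarrow> \<nu> * ?a v' \<psi> + ?b v v' \<psi> = f \<psi>"
    using assms(10,11,12) unfolding picard_operator_def picard_solution_def by blast+
  have wV: "w \<in> V_space \<Omega>"
    using V_space_lincomb[OF assms(2) sol(1) assms(11), of 1 "-1"] assms(13) by simp
  note X = V_space_imp_X_space[OF assms(11)] V_space_imp_X_space[OF sol(1)] V_space_imp_X_space[OF wV]
  note fb = bounded_odd_on_H_minus1[OF assms(2,5) card assms(7)]
  note gb = bounded_odd_on_nonlinear_residual[where \<nu> = \<nu>, OF assms(2,5) card assms(7,8)]
  note skew = convection_skew[OF assms(2,4,5,8,11)]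
  have pos: "0 \<le> F" "0 \<le> G"
    unfolding F_def G_def by (rule dual_norm_nonneg[OF assms(2)] fb gb X)+
  \<comment> \<open>both energy estimates end with the same division, which has to allow for \<open>n = 0\<close>\<close>
  have cancel: "n \<le> inverse \<nu> * D" if "\<nu> * n\<^sup>2 \<le> D * n" "0 \<le> n" "0 \<le> D" for n D
  proof (cases "n = 0")
    case False
    then have "\<nu> * n \<le> D" using that(1,2) by (simp add: power2_eq_square)
    then show ?thesis using assms(6) by (simp add: field_simps)
  qed (use that assms(6) in simp)

  \<comment> \<open>the residual equation tested with \<open>w\<close>\<close>
  have "\<nu> * (grad_norm \<Omega> w)\<^sup>2 = - ?g v w"
  proof -
    have "?a w w = ?a v' w - ?a v w"
      using grad_inner_lincomb_left[OF assms(2) X(2,1,3), of 1 "-1"] assms(13) by simp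
    then have "\<nu> * ?a w w = \<nu> * ?a v' w - \<nu> * ?a v w" by (simp add: right_diff_distrib)
    moreover have "?b v w w = ?b v v' w - ?b v v w"
      using convection_lincomb_advected[OF assms(2,8) X(1,2,1,3), of 1 "-1"] assms(13) by simp
    ultimately show ?thesis
      using sol(2)[OF wV] skew[OF X(3)] unfolding nonlinear_residual_def L2_norm_power2
      by linarith
  qed
  also have "\<dots> \<le> G * grad_norm \<Omega> w"
    using abs_le_dual_norm[OF assms(2) gb[OF X(1)] wV] unfolding G_def by linarith
  finally have w_le: "grad_norm \<Omega> w \<le> inverse \<nu> * G"
    by (rule cancel) (simp_all add: L2_norm_nonneg pos)

  \<comment> \<open>the Picard equation tested with its solution\<close>
  have "\<nu> * (grad_norm \<Omega> v')\<^sup>2 = f v'"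
    using sol(2)[OF sol(1)] skew[OF X(2)] by (simp add: L2_norm_power2)
  also have "\<dots> \<le> F * grad_norm \<Omega> v'"
    using abs_le_dual_norm[OF assms(2) fb X(2)] unfolding F_def by linarith
  finally have v'_le: "grad_norm \<Omega> v' \<le> inverse \<nu> * F"
    by (rule cancel) (simp_all add: L2_norm_nonneg pos)

  \<comment> \<open>the Picard equation leaves only the convective term in the residual of \<open>v'\<close>\<close>
  have g': "?g v' \<psi> \<le> (M * grad_norm \<Omega> w * grad_norm \<Omega> v') * grad_norm \<Omega> \<psi>" if \<psi>: "\<psi> \<in> V_space \<Omega>" for \<psi>
  proof -
    note \<psi>X = V_space_imp_X_space[OF \<psi>]
    have "?b w v' \<psi> = ?b v' v' \<psi> - ?b v v' \<psi>"
      using convection_lincomb_advecting[OF assms(8) X(2,1,2) \<psi>X, of 1 "-1"] assms(13) by simp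
    then have "?g v' \<psi> = ?b w v' \<psi>"
      using sol(2)[OF \<psi>] by (simp add: nonlinear_residual_def)
    with convection_bound[OF assms(2,8) X(3,2) \<psi>X] show ?thesis by linarith
  qed

  have "dual_norm \<Omega> (V_space \<Omega>) (?g v') \<le> \<kappa> * G"
  proof (cases "0 \<le> M")
    case True
    have "dual_norm \<Omega> (V_space \<Omega>) (?g v') \<le> M * grad_norm \<Omega> w * grad_norm \<Omega> v'"
      by (rule dual_norm_le[OF gb[OF X(2)] _ g']) (simp add: True L2_norm_nonneg)
    also have "\<dots> \<le> M * (inverse \<nu> * G) * (inverse \<nu> * F)"
      using True w_le v'_le pos assms(6)
      by (intro mult_mono mult_left_mono) (auto simp: L2_norm_nonneg)
    also have "\<dots> = \<kappa> * G"
      by (simp add: assms(9) F_def power_int_minus power2_eq_square mult.assoc mult.left_commute mult.commute)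
    finally show ?thesis .
  next
    case False
    \<comment> \<open>a negative \<open>M\<close> can bound absolute values only if all gradient norms vanish; then both sides are zero\<close>
    have zero: "grad_norm \<Omega> u = 0" if "u \<in> X_space \<Omega>" for u
    proof (rule ccontr)
      assume "grad_norm \<Omega> u \<noteq> 0"
      then have "0 < grad_norm \<Omega> u * grad_norm \<Omega> u * grad_norm \<Omega> u"
        using L2_norm_nonneg[of \<Omega> "grad \<Omega> u"] by simp
      then have "M * grad_norm \<Omega> u * grad_norm \<Omega> u * grad_norm \<Omega> u < 0"
        using False by (simp add: mult.assoc mult_neg_pos)
      with convection_bound[OF assms(2,8) that that that] show False by linarith
    qed
    have "F \<le> 0" unfolding F_def
      by (rule dual_norm_le[OF fb]) (use abs_le_dual_norm[OF assms(2) fb] zero in fastforce)+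
    then have "\<kappa> = 0" using pos assms(9) by (simp add: F_def)
    moreover have "dual_norm \<Omega> (V_space \<Omega>) (?g v') \<le> 0"
      by (rule dual_norm_le[OF gb[OF X(2)]]) (use g' zero[OF V_space_imp_X_space] in fastforce)+
    ultimately show ?thesis by simp
  qed
  with w_le show ?thesis by (simp add: G_def)
qed

end
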